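(* Let $\beta=0.0444443$ and $$s(q,v)=\left(\sum_{1\le i<j\le N}\frac{(v_i-v_j)^T(v_i-v_j)}{(q_i-q_j)^T(q_i-q_j)}+\sum_{1\le i<j\le N}\frac{K_i(q)+K_j(q)}{\sqrt{(q_i-q_j)^T(q_i-q_j)}}\right)^{-1/2},\qquad K_i(q)=\sum_{\substack{k=1\\k\ne i}}^N\frac{G m_k}{(q_i-q_k)^T(q_i-q_k)}.$$ For arbitrary $q^0\in\mathbb{R}^{3N}\setminus\Delta$, $v^0\in\mathbb{R}^{3N}$, let $(\hat q(\tau),\hat v(\tau))$ be the solution of $$\frac{d\hat q_i}{d\tau}=s(\hat q,\hat v)\,\hat v_i,\qquad \frac{d\hat v_i}{d\tau}=s(\hat q,\hat v)\sum_{j\ne i}\frac{G m_j}{\|\hat q_i-\hat q_j\|^3}(\hat q_j-\hat q_i),\qquad i=1,\dots,N,$$ with $\hat q(0)=q^0$, $\hat v(0)=v^0$. Then, in terms of the new variable $\sigma$ related to $\tau$ by the conformal mapping $$\tau\mapsto\sigma=\frac{\exp\left(\frac{\pi}{2\beta}\tau\right)-1}{\exp\left(\frac{\pi}{2\beta}\tau\right)+1},$$ which maps the strip $\{\tau\in\mathbb{C}:|\mathrm{Im}(\tau)|<\beta\}$ onto the open unit disk, the solution $(\hat q,\hat v)$ has a globally convergent expansion in powers of $\sigma$, i.e. a power series in $\sigma$ that converges for all $|\sigma|<1$ (and hence represents the solution for all $\tau\in\mathbb{R}$).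
   Context: $N\ge2$ is an integer, $G>0$ is the gravitational constant, $m_1,\dots,m_N>0$ are masses; $q=(q_1,\dots,q_N)$, $v=(v_1,\dots,v_N)$ with $q_i,v_i\in\mathbb{R}^3$; $\|\cdot\|$ is the Euclidean norm, and $u^Tu=\sum_k u_k^2$ (without conjugation). $\Delta=\{q\in\mathbb{R}^{3N}: q_i=q_j\text{ for some }i\ne j\}$. The system in $\tau$ is the $N$-body system $\frac{dq_i}{dt}=v_i$, $\frac{dv_i}{dt}=\sum_{j\ne i}\frac{Gm_j}{\|q_i-q_j\|^3}(q_j-q_i)$ rewritten in the fictitious time $\tau$ defined by $\frac{d\tau}{dt}=s(q(t),v(t))^{-1}$, $\tau(0)=0$. For complex arguments, $\|\hat q_i-\hat q_j\|^3$ is understood as the analytic continuation $((\hat q_i-\hat q_j)^T(\hat q_i-\hat q_j))^{3/2}$, and $s$ as the analytic continuation of its real expression. *)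

theory Defs
  imports "HOL-Analysis.Analysis"
begin

unbundle no fps_syntax

type_synonym ('a, 'n) config = "(('a, 3) vec, 'n) vec"

text \<open>
  The bodies are indexed by a finite linearly ordered type, so the number of bodies is its
  cardinality; \<open>('a, 'n) config\<close> is \<open>'a^3^'n\<close>. The formulas below are stated
  once for \<^typ>\<open>'a\<close> being the reals or the complex numbers. In the complex case \<^const>\<open>powr\<close> is
  the principal power, so on the slit domain \<open>slit_states\<close> below the formulas are holomorphic
  and continue their real counterparts analytically.
\<close>

definition usq :: "'a::comm_semiring_1^3 \<Rightarrow> 'a" where
  "usq u = (\<Sum>k\<in>UNIV. (u $ k)\<^sup>2)"

definition collisions :: "('a, 'n::finite) config set" where
  "collisions = {q. \<exists>i j. i \<noteq> j \<and> q $ i = q $ j}"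

definition K :: "real \<Rightarrow> ('n::finite \<Rightarrow> real) \<Rightarrow> ('a::real_field, 'n) config \<Rightarrow> 'n \<Rightarrow> 'a" where
  "K G m q i = (\<Sum>k\<in>UNIV - {i}. of_real (G * m k) / usq (q $ i - q $ k))"

definition s_base ::
  "real \<Rightarrow> ('n::{finite,linorder} \<Rightarrow> real) \<Rightarrow> ('a::{real_normed_field,ln}, 'n) config \<Rightarrow> ('a, 'n) config \<Rightarrow> 'a" where
  "s_base G m q v =
     (\<Sum>(i,j) | i < j. usq (v $ i - v $ j) / usq (q $ i - q $ j)) +
     (\<Sum>(i,j) | i < j. (K G m q i + K G m q j) / usq (q $ i - q $ j) powr (1/2))"

definition s ::
  "real \<Rightarrow> ('n::{finite,linorder} \<Rightarrow> real) \<Rightarrow> ('a::{real_normed_field,ln}, 'n) config \<Rightarrow> ('a, 'n) config \<Rightarrow> 'a" where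
  "s G m q v = s_base G m q v powr (-1/2)"

definition accel ::
  "real \<Rightarrow> ('n::finite \<Rightarrow> real) \<Rightarrow> ('a::{real_normed_field,ln}, 'n) config \<Rightarrow> 'n \<Rightarrow> 'a^3" where
  "accel G m q i =
     (\<Sum>j\<in>UNIV - {i}. (of_real (G * m j) / usq (q $ i - q $ j) powr (3/2)) *s (q $ j - q $ i))"

text \<open>In the real case the powers are the Euclidean norm, its cube, and an inverse square root.\<close>

lemma usq_real: "usq (u :: real^3) = (norm u)\<^sup>2"
  by (simp add: usq_def norm_vec_def L2_set_def sum_nonneg)

lemma usq_real_powr_half: "usq (u :: real^3) powr (1/2) = norm u"
  by (simp add: usq_real powr_half_sqrt)

lemma usq_real_powr_three_halves: "usq (u :: real^3) powr (3/2) = norm u ^ 3"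
proof (cases "u = 0")
  case False
  then have "usq u powr (3/2) = (norm u powr 2) powr (3/2)"
    by (simp add: usq_real flip: powr_numeral)
  also have "\<dots> = norm u powr 3"
    by (simp only: powr_powr) simp
  finally show ?thesis
    using False by (simp add: powr_numeral)
qed (simp add: usq_real)

text \<open>
  \<open>solves G m D T q v\<close>: on the open set \<open>T\<close> of (real or complex) times, the pair \<open>(q, v)\<close> stays in
  the set \<open>D\<close> of admissible states and satisfies the system in the fictitious time. For complex
  \<open>T\<close> the derivatives are complex derivatives, so the solution is holomorphic there.
\<close>

definition solves ::
  "real \<Rightarrow> ('n::{finite,linorder} \<Rightarrow> real) \<Rightarrow> (('a, 'n) config \<times> ('a, 'n) config) set \<Rightarrow> 'a set \<Rightarrow>
   ('a::{real_normed_field,ln} \<Rightarrow> ('a, 'n) config) \<Rightarrow> ('a \<Rightarrow> ('a, 'n) config) \<Rightarrow> bool" where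
  "solves G m D T q v \<longleftrightarrow>
     (\<forall>\<tau>\<in>T. (q \<tau>, v \<tau>) \<in> D \<and>
       (\<forall>i k.
         ((\<lambda>t. q t $ i $ k) has_field_derivative s G m (q \<tau>) (v \<tau>) * v \<tau> $ i $ k) (at \<tau>) \<and>
         ((\<lambda>t. v t $ i $ k) has_field_derivative
            s G m (q \<tau>) (v \<tau>) * accel G m (q \<tau>) i $ k) (at \<tau>)))"

definition real_states :: "((real, 'n::finite) config \<times> (real, 'n) config) set" where
  "real_states = (- collisions) \<times> UNIV"

definition slit_states ::
  "real \<Rightarrow> ('n::{finite,linorder} \<Rightarrow> real) \<Rightarrow> ((complex, 'n) config \<times> (complex, 'n) config) set" where
  "slit_states G m =
     {(q, v). (\<forall>i j. i \<noteq> j \<longrightarrow> usq (q $ i - q $ j) \<notin> \<real>\<^sub>\<le>\<^sub>0) \<and> s_base G m q v \<notin> \<real>\<^sub>\<le>\<^sub>0}"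

definition complexify :: "(real, 'n::finite) config \<Rightarrow> (complex, 'n) config" where
  "complexify q = (\<chi> i k. of_real (q $ i $ k))"

definition \<beta> :: real where
  "\<beta> = 0.0444443"

definition strip :: "complex set" where
  "strip = {\<tau>. \<bar>Im \<tau>\<bar> < \<beta>}"

definition \<sigma> :: "complex \<Rightarrow> complex" where
  "\<sigma> \<tau> = (exp (of_real (pi / (2 * \<beta>)) * \<tau>) - 1) / (exp (of_real (pi / (2 * \<beta>)) * \<tau>) + 1)"

end

theory Submission
  imports Defs "HOL-Complex_Analysis.Conformal_Mappings"
begin

text \<open>
  The factor \<open>s\<close> is chosen so that the system in the fictitious time has no preferred scale: the
  time it takes a solution to change appreciably, relative to its own mutual distances, is bounded
  below by a number that depends neither on the state nor on the masses nor on the number of bodies.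
  This holds for complex times as well, and \<open>\<beta>\<close> is such a number.

  Around a real state with mutual distances \<open>r i j\<close>, consider the complex states in which every
  relative position has moved by at most a small fraction of \<open>r i j\<close>, and every velocity by at most
  a small multiple of \<open>s * K i\<close>, the natural unit for the change of \<open>v i\<close> (the set \<open>tube\<close>).
  There each squared distance \<open>usq (q i - q j)\<close> stays close to \<open>r i j\<close> squared, in the relative
  sense. At the real state \<open>s_base\<close> is a sum of nonnegative terms, and each term (or each velocity
  term together with the potential term of the same pair) changes by a fixed fraction less than one,
  so \<open>s_base\<close> does too: it stays in the right half plane and \<open>s\<close> stays comparable to its real value
  (\<open>s_base_tube\<close>, \<open>s_tube\<close>). Since \<open>s\<close> times the relative speed of a pair is at most \<open>r i j\<close>, and
  \<open>s\<close> squared times its potential term is at most one, the right-hand sides are bounded in these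
  natural units (\<open>velocity_tube\<close>, \<open>force_tube\<close>). Multiplied by \<open>\<beta>\<close>, the bounds are smaller than the
  width of the tube. Hence Picard iteration on the disk \<open>|\<tau>| < \<beta>\<close> never leaves the tube and yields a
  holomorphic solution there (\<open>picard_ball\<close>, \<open>local_solution\<close>), which is real on the real axis. The
  Lipschitz constant needed for convergence comes for free from Cauchy's inequality on complex lines,
  since the field is bounded on a slightly larger tube (\<open>cauchy_lipschitz\<close>).

  The radius \<open>\<beta>\<close> is the same at every real state, so the real solution can be continued by steps of a
  fixed length and exists for all real times (\<open>global_continuation\<close>). The disks of radius \<open>\<beta>\<close> with
  real centres cover the strip; the local solutions on them agree with the global real solution near
  the real axis, hence with each other by the identity theorem, and glue to a holomorphic solution on
  the strip (\<open>complex_continuation\<close>). Composed with the inverse of the conformal map \<open>\<sigma>\<close> it becomes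
  holomorphic on the unit disk, where its Taylor series at the origin converges
  (\<open>power_series_in_\<sigma>\<close>).
\<close>

section \<open>Holomorphic solutions by Picard iteration on a disk\<close>

text \<open>Integration along the segment from the origin. The exponential weight gains a factor \<open>1 / K\<close>, which
  is what makes Picard iteration contract on a disk of any radius.\<close>

lemma exp_growth_bound:
  fixes f f' :: "complex \<Rightarrow> complex" and K c R :: real
  assumes df: "\<And>z. z \<in> ball 0 R \<Longrightarrow> (f has_field_derivative f' z) (at z)"
    and bd: "\<And>z. z \<in> ball 0 R \<Longrightarrow> norm (f' z) \<le> c * exp (K * norm z)"
    and f0: "f 0 = 0" and K: "K > 0" and z: "z \<in> ball 0 R"
  shows "norm (f z) \<le> c / K * exp (K * norm z)"
proof -
  have R: "R > 0" using z by (auto intro: le_less_trans[OF norm_ge_zero])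
  have c: "c \<ge> 0" using bd[of 0] R by (auto intro: order_trans[OF norm_ge_zero])
  have mem: "of_real t * z \<in> ball 0 R" if "0 \<le> t" "t \<le> 1" for t
    using z that mult_left_le_one_le[of "norm z" t] by (auto simp: norm_mult)
  have dp: "((\<lambda>t. of_real t * z) has_vector_derivative z) (at t)" for t
    by (auto intro!: derivative_eq_intros)
  have d: "((\<lambda>t. f (of_real t * z)) has_vector_derivative z * f' (of_real t * z)) (at t)"
    if "0 \<le> t" "t \<le> 1" for t
    using field_vector_diff_chain_at[OF dp df[OF mem[OF that]]] by (simp add: o_def)
  have "norm (f (of_real 1 * z) - f (of_real 0 * z))
      \<le> c / K * exp (K * (1 * norm z)) - c / K * exp (K * (0 * norm z))"
  proof (rule differentiable_bound_general[where f = "\<lambda>t. f (of_real t * z)"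
        and \<phi> = "\<lambda>t. c / K * exp (K * (t * norm z))"
        and \<phi>' = "\<lambda>t. c * norm z * exp (K * (t * norm z))"])
    show "continuous_on {0..1} (\<lambda>t. f (complex_of_real t * z))"
      using d by (intro continuous_at_imp_continuous_on ballI)
        (auto intro: has_vector_derivative_continuous)
    fix t :: real assume t: "0 < t" "t < 1"
    show "((\<lambda>t. f (of_real t * z)) has_vector_derivative z * f' (of_real t * z)) (at t)"
      using d t by auto
    show "((\<lambda>t. c / K * exp (K * (t * norm z))) has_vector_derivative
        c * norm z * exp (K * (t * norm z))) (at t)"
      unfolding has_real_derivative_iff_has_vector_derivative[symmetric]
      using K by (auto intro!: derivative_eq_intros)
    have "norm (f' (of_real t * z)) \<le> c * exp (K * (t * norm z))"
      using bd[OF mem[of t]] t by (simp add: norm_mult)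
    then show "norm (z * f' (of_real t * z)) \<le> c * norm z * exp (K * (t * norm z))"
      using mult_left_mono[of _ _ "norm z"] by (fastforce simp: norm_mult mult_ac)
  qed (use K in \<open>auto intro!: continuous_intros\<close>)
  then have "norm (f z) \<le> c / K * exp (K * norm z) - c / K" using f0 by simp
  moreover have "c / K \<ge> 0" using c K by simp
  ultimately show ?thesis by linarith
qed

text \<open>The predicate \<open>A\<close> collects whatever is known of all iterates. It must confine them to \<open>D\<close>, where the
  field is Lipschitz; it may carry more, such as being real on the real axis, and every such property
  passes to the solution because \<open>A\<close> is preserved by a Picard step and by pointwise limits.\<close>

lemma picard_ball:
  fixes F :: "('k::finite \<Rightarrow> complex) \<Rightarrow> 'k \<Rightarrow> complex" and x0 :: "'k \<Rightarrow> complex"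
    and A :: "(complex \<Rightarrow> 'k \<Rightarrow> complex) \<Rightarrow> bool"
  assumes R: "R > 0" and A0: "A (\<lambda>z. x0)"
    and A_step: "\<And>X Y. A X \<Longrightarrow> Y 0 = x0 \<Longrightarrow>
      (\<And>z k. z \<in> ball 0 R \<Longrightarrow> ((\<lambda>z. Y z k) has_field_derivative F (X z) k) (at z)) \<Longrightarrow> A Y"
    and A_lim: "\<And>Xs X. (\<And>n. A (Xs n)) \<Longrightarrow>
      (\<And>z k. z \<in> ball 0 R \<Longrightarrow> (\<lambda>n. Xs n z k) \<longlonglongrightarrow> X z k) \<Longrightarrow> A X"
    and A_dom: "\<And>X z. A X \<Longrightarrow> z \<in> ball 0 R \<Longrightarrow> X z \<in> D"
    and hol: "\<And>X k. A X \<Longrightarrow> (\<And>k. (\<lambda>z. X z k) holomorphic_on ball 0 R) \<Longrightarrow>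
      (\<lambda>z. F (X z) k) holomorphic_on ball 0 R"
    and lip: "\<And>x y k. x \<in> D \<Longrightarrow> y \<in> D \<Longrightarrow> norm (F x k - F y k) \<le> L * (\<Sum>j\<in>UNIV. norm (x j - y j))"
  obtains X where "A X" "X 0 = x0"
    "\<And>z k. z \<in> ball 0 R \<Longrightarrow> ((\<lambda>z. X z k) has_field_derivative F (X z) k) (at z)"
proof -
  define L' where "L' = \<bar>L\<bar> + 1"
  have lip': "norm (F x k - F y k) \<le> L' * (\<Sum>j\<in>UNIV. norm (x j - y j))"
    if "x \<in> D" "y \<in> D" for x y k
    using lip[OF that] by (rule order_trans) (auto simp: L'_def sum_nonneg intro!: mult_right_mono)
  have L'pos: "L' > 0" by (simp add: L'_def)
  define P where "P = (\<lambda>(n::nat) X. A X \<and> X 0 = x0 \<and> (\<forall>k. (\<lambda>z. X z k) holomorphic_on ball 0 R)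
      \<and> (n = 0 \<longrightarrow> X = (\<lambda>z. x0)))"
  define Q where "Q = (\<lambda>(n::nat) X Y. \<forall>z\<in>ball 0 R. \<forall>k. ((\<lambda>z. Y z k) has_field_derivative F (X z) k) (at z))"
  have "\<exists>Xs. \<forall>n. P n (Xs n) \<and> Q n (Xs n) (Xs (Suc n))"
  proof (rule dependent_nat_choice)
    show "\<exists>X. P 0 X" using A0 by (auto simp: P_def)
    fix X n assume PX: "P n X"
    have "\<exists>y. y 0 = x0 k \<and> (\<forall>z\<in>ball 0 R. (y has_field_derivative F (X z) k) (at z))" for k
    proof -
      have "(\<lambda>z. F (X z) k) holomorphic_on ball 0 R"
        using PX by (intro hol) (auto simp: P_def)
      then obtain g where g: "\<And>z. z \<in> ball 0 R \<Longrightarrow>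
          (g has_field_derivative F (X z) k) (at z within ball 0 R)"
        using holomorphic_convex_primitive'[of "ball 0 R" "\<lambda>z. F (X z) k"] by auto
      have "((\<lambda>z. g z - g 0 + x0 k) has_field_derivative F (X z) k) (at z)" if "z \<in> ball 0 R" for z
        using g[OF that] at_within_open[OF that open_ball] by (auto intro!: derivative_eq_intros)
      then show ?thesis by (intro exI[of _ "\<lambda>z. g z - g 0 + x0 k"]) auto
    qed
    then obtain y where y: "\<And>k. y k 0 = x0 k"
      "\<And>k z. z \<in> ball 0 R \<Longrightarrow> (y k has_field_derivative F (X z) k) (at z)" by metis
    define Y where "Y = (\<lambda>z k. y k z)"
    have "A Y" using PX by (intro A_step[of X Y]) (auto simp: P_def Y_def y)
    moreover have "(\<lambda>z. Y z k) holomorphic_on ball 0 R" for k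
      unfolding Y_def by (rule holomorphic_onI) (use y(2) in \<open>meson field_differentiable_at_within field_differentiable_def\<close>)
    ultimately have "P (Suc n) Y \<and> Q n X Y" using y by (auto simp: P_def Q_def Y_def)
    then show "\<exists>Y. P (Suc n) Y \<and> Q n X Y" by blast
  qed
  then obtain Xs where P: "\<And>n. P n (Xs n)" and Q: "\<And>n. Q n (Xs n) (Xs (Suc n))" by blast
  have XA: "A (Xs n)" and X0: "Xs n 0 = x0" for n using P[of n] by (auto simp: P_def)
  have XD: "Xs n z \<in> D" if "z \<in> ball 0 R" for n z using A_dom[OF XA that] .
  have dX: "((\<lambda>z. Xs (Suc n) z k) has_field_derivative F (Xs n z) k) (at z)" if "z \<in> ball 0 R" for n z k
    using Q that by (auto simp: Q_def)
  define N where "N = real CARD('k)"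
  have N: "N > 0" by (simp add: N_def)
  define K where "K = 2 * N * L'"
  have K: "K > 0" using N L'pos by (simp add: K_def)
  define C where "C = (\<Sum>k\<in>UNIV. norm (F x0 k) / K)"
  have C0: "C \<ge> 0" using K by (auto simp: C_def intro!: sum_nonneg)
  have bound: "(\<Sum>k\<in>UNIV. norm (Xs (Suc n) z k - Xs n z k)) \<le> C * (1/2) ^ n * exp (K * norm z)"
    if "z \<in> ball 0 R" for n z
    using that
  proof (induction n arbitrary: z)
    case 0
    have Xs0: "Xs 0 = (\<lambda>z. x0)" using P[of 0] by (simp add: P_def)
    have "norm (Xs (Suc 0) z k - x0 k) \<le> norm (F x0 k) / K * exp (K * norm z)" for k
    proof (rule exp_growth_bound[where R = R and f' = "\<lambda>z. F x0 k"])
      fix w :: complex assume w: "w \<in> ball 0 R"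
      show "((\<lambda>z. Xs (Suc 0) z k - x0 k) has_field_derivative F x0 k) (at w)"
        using dX[OF w, of 0 k] by (auto intro!: derivative_eq_intros simp: Xs0)
      show "norm (F x0 k) \<le> norm (F x0 k) * exp (K * norm w)"
        using K by (simp add: mult_le_cancel_left1)
    qed (use X0 K 0 in auto)
    then show ?case
      by (auto simp: Xs0 C_def sum_distrib_right intro!: sum_mono)
  next
    case (Suc n)
    have "norm (Xs (Suc (Suc n)) z k - Xs (Suc n) z k) \<le> L' * (C * (1/2) ^ n) / K * exp (K * norm z)" for k
    proof (rule exp_growth_bound[where R = R and f' = "\<lambda>z. F (Xs (Suc n) z) k - F (Xs n z) k"])
      fix w :: complex assume w: "w \<in> ball 0 R"
      show "((\<lambda>z. Xs (Suc (Suc n)) z k - Xs (Suc n) z k) has_field_derivative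
          F (Xs (Suc n) w) k - F (Xs n w) k) (at w)"
        by (intro derivative_intros dX w)
      have "norm (F (Xs (Suc n) w) k - F (Xs n w) k) \<le> L' * (\<Sum>j\<in>UNIV. norm (Xs (Suc n) w j - Xs n w j))"
        by (intro lip' XD w)
      also have "\<dots> \<le> L' * (C * (1/2) ^ n * exp (K * norm w))"
        using Suc.IH[OF w] L'pos by (intro mult_left_mono) auto
      finally show "norm (F (Xs (Suc n) w) k - F (Xs n w) k) \<le> L' * (C * (1/2) ^ n) * exp (K * norm w)"
        by (simp add: mult.assoc)
    qed (use X0 K Suc.prems in auto)
    then have "(\<Sum>k\<in>UNIV. norm (Xs (Suc (Suc n)) z k - Xs (Suc n) z k))
        \<le> N * (L' * (C * (1/2) ^ n) / K * exp (K * norm z))"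
      unfolding N_def by (intro sum_bounded_above[where A = UNIV, simplified]) auto
    also have "\<dots> = C * (1/2) ^ Suc n * exp (K * norm z)"
      using N L'pos by (simp add: K_def)
    finally show ?case .
  qed
  define B where "B = C * exp (K * R)"
  have bound': "norm (Xs (Suc n) z k - Xs n z k) \<le> B * (1/2) ^ n" if "z \<in> ball 0 R" for n z k
  proof -
    have "norm (Xs (Suc n) z k - Xs n z k) \<le> (\<Sum>k\<in>UNIV. norm (Xs (Suc n) z k - Xs n z k))"
      by (rule member_le_sum) auto
    also have "\<dots> \<le> C * (1/2) ^ n * exp (K * norm z)" by (rule bound[OF that])
    also have "\<dots> \<le> C * (1/2) ^ n * exp (K * R)"
      using that K C0 by (intro mult_left_mono) auto
    finally show ?thesis by (simp add: B_def mult_ac)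
  qed
  have "uniform_limit (ball 0 R) (\<lambda>n z. \<Sum>i<n. Xs (Suc i) z k - Xs i z k)
      (\<lambda>z. \<Sum>i. Xs (Suc i) z k - Xs i z k) sequentially" for k
    by (rule Weierstrass_m_test[where M = "\<lambda>n. B * (1/2) ^ n"])
      (auto simp: bound' intro!: summable_mult summable_geometric)
  then have ul: "uniform_limit (ball 0 R) (\<lambda>n z. Xs n z k - Xs 0 z k)
      (\<lambda>z. \<Sum>i. Xs (Suc i) z k - Xs i z k) sequentially" for k
    unfolding sum_lessThan_telescope[of "\<lambda>i. Xs i _ k" for k] .
  define X where "X = (\<lambda>z k. (\<Sum>i. Xs (Suc i) z k - Xs i z k) + Xs 0 z k)"
  have unif: "uniform_limit (ball 0 R) (\<lambda>n z. Xs n z k) (\<lambda>z. X z k) sequentially" for k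
    using uniform_limit_add[OF ul[of k] uniform_limit_const[where c = "\<lambda>z. Xs 0 z k"]]
    by (simp add: X_def)
  have lim: "(\<lambda>n. Xs n z k) \<longlonglongrightarrow> X z k" if "z \<in> ball 0 R" for z k
    using tendsto_uniform_limitI[OF unif that] .
  have AX: "A X" by (rule A_lim[OF XA lim])
  have X00: "X 0 = x0"
  proof
    fix k show "X 0 k = x0 k"
      using lim[of 0 k] R by (simp add: X0 LIMSEQ_const_iff)
  qed
  have "((\<lambda>z. X z k) has_field_derivative F (X z) k) (at z)" if z: "z \<in> ball 0 R" for z k
  proof -
    have "\<exists>g'. \<forall>x\<in>ball 0 R. ((\<lambda>z. X z k) has_field_derivative g' x) (at x) \<and> (\<lambda>n. F (Xs n x) k) \<longlonglongrightarrow> g' x"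
    proof (rule has_complex_derivative_uniform_sequence[where f = "\<lambda>n z. Xs (Suc n) z k"])
      fix x :: complex assume x: "x \<in> ball 0 R"
      then obtain d where d: "d > 0" "cball x d \<subseteq> ball 0 R" using open_contains_cball by blast
      have "uniform_limit (ball 0 R) (\<lambda>n z. Xs (Suc n) z k) (\<lambda>z. X z k) sequentially"
        by (rule filterlim_compose[OF unif filterlim_Suc])
      then show "\<exists>d>0. cball x d \<subseteq> ball 0 R \<and>
          uniform_limit (cball x d) (\<lambda>n z. Xs (Suc n) z k) (\<lambda>z. X z k) sequentially"
        using d uniform_limit_on_subset by blast
    qed (auto simp: dX)
    then obtain g' where g': "((\<lambda>z. X z k) has_field_derivative g' z) (at z)"
      "(\<lambda>n. F (Xs n z) k) \<longlonglongrightarrow> g' z" using z by blast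
    have "(\<lambda>n. F (Xs n z) k) \<longlonglongrightarrow> F (X z) k"
    proof (rule LIM_zero_cancel, rule Lim_null_comparison)
      show "\<forall>\<^sub>F n in sequentially. norm (F (Xs n z) k - F (X z) k)
          \<le> L' * (\<Sum>j\<in>UNIV. norm (Xs n z j - X z j))"
        by (intro always_eventually allI lip' XD A_dom[OF AX] z)
      have "(\<lambda>n. L' * (\<Sum>j\<in>UNIV. norm (Xs n z j - X z j))) \<longlonglongrightarrow> L' * (\<Sum>j\<in>(UNIV::'k set). norm (X z j - X z j))"
        by (intro tendsto_mult tendsto_const tendsto_sum tendsto_norm tendsto_diff lim[OF z])
      then show "(\<lambda>n. L' * (\<Sum>j\<in>UNIV. norm (Xs n z j - X z j))) \<longlonglongrightarrow> 0" by simp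
    qed
    from LIMSEQ_unique[OF g'(2) this] g'(1) show ?thesis by simp
  qed
  with AX X00 show thesis by (rule that)
qed

text \<open>A bound on a neighbourhood suffices for a Lipschitz constant: restricted to the complex line through
  two points, \<open>f\<close> is a holomorphic function of one variable, and Cauchy's inequality bounds its
  derivative along the segment. No partial derivative has to be computed.\<close>

lemma cauchy_lipschitz:
  fixes f :: "('k::finite \<Rightarrow> complex) \<Rightarrow> complex"
  assumes conv: "\<And>x y t. x \<in> D \<Longrightarrow> y \<in> D \<Longrightarrow> 0 \<le> t \<Longrightarrow> t \<le> 1 \<Longrightarrow>
        (\<lambda>j. x j + of_real t * (y j - x j)) \<in> D"
    and nbhd: "\<And>x y. x \<in> D \<Longrightarrow> (\<Sum>j\<in>UNIV. norm (y j - x j)) \<le> \<delta> \<Longrightarrow> y \<in> D'"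
    and d: "\<delta> > 0"
    and hol: "\<And>x h S. open S \<Longrightarrow> (\<And>z. z \<in> S \<Longrightarrow> (\<lambda>j. x j + z * h j) \<in> D') \<Longrightarrow>
        (\<lambda>z. f (\<lambda>j. x j + z * h j)) holomorphic_on S"
    and bd: "\<And>x. x \<in> D' \<Longrightarrow> norm (f x) \<le> M"
    and x: "x \<in> D" and y: "y \<in> D"
  shows "norm (f x - f y) \<le> 2 * M / \<delta> * (\<Sum>j\<in>UNIV. norm (x j - y j))"
proof (cases "x = y")
  case False
  define h where "h = (\<lambda>j. y j - x j)"
  define N where "N = (\<Sum>j\<in>UNIV. norm (h j))"
  obtain j where "h j \<noteq> 0" using False by (force simp: h_def)
  then have N: "N > 0" unfolding N_def by (intro sum_pos2[where i = j]) auto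
  define r where "r = \<delta> / N"
  have r: "r > 0" using N d by (simp add: r_def)
  define g where "g = (\<lambda>z. f (\<lambda>j. x j + z * h j))"
  have line: "(\<lambda>j. x j + of_real t * h j) \<in> D" if "0 \<le> t" "t \<le> 1" for t
    unfolding h_def using conv[OF x y that] .
  have near: "(\<lambda>j. x j + w * h j) \<in> D'" if "0 \<le> t" "t \<le> 1" "w \<in> cball (of_real t) r" for t w
  proof (rule nbhd[OF line[OF that(1,2)]])
    have "norm (x j + w * h j - (x j + of_real t * h j)) = norm (w - of_real t) * norm (h j)" for j
      by (simp add: norm_mult[symmetric] algebra_simps)
    then have "(\<Sum>j\<in>UNIV. norm (x j + w * h j - (x j + of_real t * h j))) = norm (w - of_real t) * N"
      by (simp add: N_def sum_distrib_left)
    also have "\<dots> \<le> r * N" using that(3) N by (intro mult_right_mono) (auto simp: dist_norm norm_minus_commute)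
    also have "\<dots> = \<delta>" using N by (simp add: r_def)
    finally show "(\<Sum>j\<in>UNIV. norm (x j + w * h j - (x j + of_real t * h j))) \<le> \<delta>" .
  qed
  define S where "S = (\<lambda>t. of_real t :: complex) ` {0..1}"
  have convS: "convex S" unfolding S_def
    by (intro convex_linear_image) (auto simp: linear_of_real)
  \<comment> \<open>on each disk of radius \<open>r\<close> centred on the segment the restriction of \<open>f\<close> to the complex line
     is bounded by \<open>M\<close>, so Cauchy's inequality bounds its derivative\<close>
  have "norm (g 1 - g 0) \<le> (2 * M / r) * norm (1 - 0 :: complex)"
  proof (rule field_differentiable_bound[OF convS, where f' = "deriv g"])
    fix z assume "z \<in> S"
    then obtain t where t: "0 \<le> t" "t \<le> 1" "z = of_real t" by (auto simp: S_def)
    have holg: "g holomorphic_on ball z r'" if "r' \<le> r" for r'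
      unfolding g_def t(3) using near[OF t(1,2)] that by (intro hol) auto
    have "z \<in> ball z r" using r by simp
    then have "(g has_field_derivative deriv g z) (at z)"
      using holomorphic_derivI[OF holg[of r] open_ball] by blast
    then show "(g has_field_derivative deriv g z) (at z within S)"
      by (rule has_field_derivative_at_within)
    have *: "norm (deriv g z) \<le> M / r'" if r': "0 < r'" "r' < r" for r'
    proof -
      have "g holomorphic_on cball z r'" using holg[of r] r' by (auto elim!: holomorphic_on_subset)
      then have "norm ((deriv ^^ 1) g z) \<le> fact 1 * M / r' ^ 1"
        using r' holg[of r'] near[OF t(1,2)] bd
        by (intro Cauchy_inequality) (auto simp: g_def t(3) dist_norm intro!: holomorphic_on_imp_continuous_on)
      then show ?thesis by simp
    qed
    show "norm (deriv g z) \<le> 2 * M / r" using *[of "r / 2"] r by (simp add: mult.commute)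
  qed (auto simp: S_def image_iff intro: bexI[of _ 0] bexI[of _ 1])
  then have "norm (f y - f x) \<le> 2 * M / r" by (simp add: g_def h_def)
  also have "2 * M / r = 2 * M / \<delta> * N" using N d by (simp add: r_def)
  also have "N = (\<Sum>j\<in>UNIV. norm (x j - y j))" by (simp add: N_def h_def norm_minus_commute)
  finally show ?thesis by (simp add: norm_minus_commute)
qed auto

section \<open>Perturbing a real vector of \<open>\<real>\<^sup>3\<close> into \<open>\<complex>\<^sup>3\<close>\<close>

definition cvec :: "real^3 \<Rightarrow> complex^3" where
  "cvec u = (\<chi> k. of_real (u $ k))"

lemma complexify_nth: "complexify q $ i = cvec (q $ i)"
  by (simp add: complexify_def cvec_def vec_eq_iff)

lemma cvec_nth [simp]: "cvec u $ k = of_real (u $ k)"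
  by (simp add: cvec_def)

lemma cvec_diff: "cvec (u - w) = cvec u - cvec w"
  by (simp add: cvec_def vec_eq_iff)

lemma norm_sq_complex3: "(norm (u :: complex^3))\<^sup>2 = (\<Sum>k\<in>UNIV. (cmod (u $ k))\<^sup>2)"
  by (simp add: norm_vec_def L2_set_def sum_nonneg)

lemma norm_cvec [simp]: "norm (cvec u) = norm u"
  by (simp add: norm_vec_def L2_set_def)

lemma usq_cvec: "usq (cvec u) = of_real ((norm u)\<^sup>2)"
  by (simp add: usq_real[symmetric] usq_def)

lemma norm_vector_smult: "norm (c *s (u :: complex^3)) = cmod c * norm u"
  by (simp add: norm_vec_def L2_set_right_distrib norm_mult)

lemma norm_usq_le: "cmod (usq u) \<le> (norm u)\<^sup>2"
  unfolding usq_def norm_sq_complex3 by (rule order_trans[OF norm_sum]) (simp add: norm_power)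

lemma norm_inner_le: "cmod (\<Sum>k\<in>UNIV. u $ k * w $ k) \<le> norm (u :: complex^3) * norm w"
proof -
  have "cmod (\<Sum>k\<in>UNIV. u $ k * w $ k) \<le> (\<Sum>k\<in>UNIV. \<bar>cmod (u $ k)\<bar> * \<bar>cmod (w $ k)\<bar>)"
    by (rule order_trans[OF norm_sum]) (simp add: norm_mult)
  also have "\<dots> \<le> norm u * norm w" unfolding norm_vec_def by (rule L2_set_mult_ineq)
  finally show ?thesis .
qed

text \<open>The usual expansion of a square. The bilinear form of \<open>usq\<close> has no conjugation, but in modulus it
  still obeys the Cauchy-Schwarz inequality for the Hermitian norm.\<close>

lemma usq_perturb:
  "cmod (usq u - of_real ((norm a)\<^sup>2)) \<le> 2 * norm a * norm (u - cvec a) + (norm (u - cvec a))\<^sup>2"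
proof -
  define w where "w = u - cvec a"
  have "usq u - of_real ((norm a)\<^sup>2) = usq (cvec a + w) - usq (cvec a)"
    by (simp add: usq_cvec w_def)
  also have "\<dots> = 2 * (\<Sum>k\<in>UNIV. cvec a $ k * w $ k) + usq w"
    unfolding usq_def by (simp add: power2_eq_square algebra_simps sum.distrib sum_distrib_left)
  finally have "cmod (usq u - of_real ((norm a)\<^sup>2)) \<le> 2 * cmod (\<Sum>k\<in>UNIV. cvec a $ k * w $ k) + cmod (usq w)"
    by (metis (no_types, lifting) norm_mult norm_numeral norm_triangle_ineq)
  then show ?thesis
    using norm_inner_le[of "cvec a" w] norm_usq_le[of w] by (simp add: w_def)
qed

lemma inverse_near_one:
  assumes "cmod (w - 1) \<le> 1/6"
  shows "cmod (1 / w - 1) \<le> 1/5" "cmod w \<ge> 5/6" "cmod (1 / w) \<le> 6/5"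
proof -
  have n: "cmod w \<ge> 5/6" using assms norm_triangle_ineq2[of 1 "1 - w"] by (simp add: norm_minus_commute)
  then show "cmod w \<ge> 5/6" by simp
  have w0: "w \<noteq> 0" using n by auto
  have "cmod (1 / w - 1) = cmod (w - 1) / cmod w"
    using w0 by (simp add: norm_divide[symmetric] diff_divide_distrib norm_minus_commute)
  also have "\<dots> \<le> (1/6) / (5/6)" using assms n by (intro frac_le) auto
  finally show "cmod (1 / w - 1) \<le> 1/5" by simp
  show "cmod (1 / w) \<le> 6/5" using n w0 by (simp add: norm_divide field_simps)
qed

(* the simplifier would otherwise expand csqrt into real and imaginary parts *)
declare csqrt.simps [simp del]

text \<open>Because \<open>(csqrt w - 1) * (csqrt w + 1) = w - 1\<close> and the principal root has nonnegative real part, the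
  root is within \<open>1/6\<close> of one; feeding this back into the second factor improves it to \<open>1/11\<close>.\<close>

lemma csqrt_near_one:
  assumes "cmod (w - 1) \<le> 1/6"
  shows "cmod (1 / csqrt w - 1) \<le> 1/10"
proof -
  have eq: "(csqrt w - 1) * (csqrt w + 1) = w - 1"
    by (simp add: algebra_simps flip: power2_eq_square)
  then have prod: "cmod (csqrt w - 1) * cmod (csqrt w + 1) = cmod (w - 1)" by (metis norm_mult)
  have "1 \<le> cmod (csqrt w + 1)" using Re_csqrt[of w] complex_Re_le_cmod[of "csqrt w + 1"] by simp
  then have "cmod (csqrt w - 1) * 1 \<le> cmod (csqrt w - 1) * cmod (csqrt w + 1)"
    by (intro mult_left_mono) auto
  then have d1: "cmod (csqrt w - 1) \<le> 1/6" using prod assms by simp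
  have "Re (csqrt w) \<ge> 5/6" using abs_Re_le_cmod[of "csqrt w - 1"] d1 by simp
  then have "11/6 \<le> cmod (csqrt w + 1)"
    using complex_Re_le_cmod[of "csqrt w + 1"] by simp
  then have "cmod (csqrt w - 1) * (11/6) \<le> cmod (csqrt w - 1) * cmod (csqrt w + 1)"
    by (intro mult_left_mono) auto
  then have d2: "cmod (csqrt w - 1) \<le> 1/11" using prod assms by simp
  then have n: "cmod (csqrt w) \<ge> 10/11"
    using norm_triangle_ineq2[of 1 "1 - csqrt w"] by (simp add: norm_minus_commute)
  then have "csqrt w \<noteq> 0" by auto
  then have "1 / csqrt w - 1 = - ((csqrt w - 1) / csqrt w)" by (simp add: diff_divide_distrib)
  then have "cmod (1 / csqrt w - 1) = cmod (csqrt w - 1) / cmod (csqrt w)"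
    by (simp only: norm_minus_cancel norm_divide)
  also have "\<dots> \<le> (1/11) / (10/11)" using d2 n by (intro frac_le) auto
  finally show ?thesis by simp
qed

lemma near_one_mult:
  assumes "cmod (\<kappa> - of_real k) \<le> k / 5" "cmod (\<eta> - 1) \<le> 1/10"
  shows "cmod (\<kappa> * \<eta> - of_real k) \<le> 8/25 * k"
proof -
  have k: "k \<ge> 0" using order_trans[OF norm_ge_zero assms(1)] by simp
  have "cmod \<kappa> \<le> cmod (\<kappa> - of_real k) + k" using norm_triangle_ineq[of "\<kappa> - of_real k" "of_real k"] k by simp
  then have "cmod \<kappa> \<le> 6/5 * k" using assms by simp
  then have "cmod (\<kappa> * (\<eta> - 1)) \<le> (6/5 * k) * (1/10)"
    unfolding norm_mult using assms k by (intro mult_mono) auto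
  moreover have "\<kappa> * \<eta> - of_real k = \<kappa> * (\<eta> - 1) + (\<kappa> - of_real k)" by (simp add: algebra_simps)
  ultimately have "cmod (\<kappa> * \<eta> - of_real k) \<le> (6/5 * k) * (1/10) + k / 5"
    using norm_triangle_mono[OF _ assms(1)] by metis
  then show ?thesis by simp
qed

text \<open>With \<open>\<rho> = 2/25\<close> the relative error \<open>2 * \<rho> + \<rho>\<^sup>2\<close> of the squared distance is just below \<open>1/6\<close>. The factor
  \<open>w\<close> is the squared distance measured in units of its real value.\<close>

lemma usq_relative:
  assumes "norm (u - cvec a) \<le> 2/25 * norm a" "a \<noteq> 0"
  obtains w where "usq u = of_real ((norm a)\<^sup>2) * w" "cmod (w - 1) \<le> 1/6"
    "usq u powr (1/2) = of_real (norm a) * csqrt w"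
proof -
  define r where "r = norm a"
  have r: "r > 0" using assms by (simp add: r_def)
  define w where "w = usq u / of_real (r\<^sup>2)"
  have u: "usq u = of_real (r\<^sup>2) * w" using r by (simp add: w_def)
  have "norm (u - cvec a) * norm (u - cvec a) \<le> (2/25 * r) * (2/25 * r)"
    using assms r by (intro mult_mono) (auto simp: r_def)
  then have "(norm (u - cvec a))\<^sup>2 \<le> (2/25 * r)\<^sup>2" by (simp add: power2_eq_square)
  moreover have "2 * r * norm (u - cvec a) \<le> 2 * r * (2/25 * r)"
    using assms r by (intro mult_left_mono) (auto simp: r_def)
  ultimately have "cmod (usq u - of_real (r\<^sup>2)) \<le> 2 * r * (2/25 * r) + (2/25 * r)\<^sup>2"
    using usq_perturb[of u a] unfolding r_def by linarith
  also have "\<dots> \<le> r\<^sup>2 * (1/6)" using r by (simp add: power2_eq_square)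
  also have "usq u - of_real (r\<^sup>2) = of_real (r\<^sup>2) * (w - 1)" by (simp add: u algebra_simps)
  finally have w1: "cmod (w - 1) \<le> 1/6" using r by (simp add: norm_mult norm_power)
  have "usq u powr (1/2) = of_real (r\<^sup>2) powr (1/2) * w powr (1/2)"
    unfolding u using r by (intro powr_times_real_left) auto
  also have "of_real (r\<^sup>2) powr (1/2) = (of_real r :: complex)"
    using r by (simp flip: csqrt_conv_powr add: csqrt_of_real)
  finally have "usq u powr (1/2) = of_real r * csqrt w" by (simp add: csqrt_conv_powr)
  then show thesis using that[of w] u w1 unfolding r_def by blast
qed

lemma usq_slit:
  assumes "norm (u - cvec a) \<le> 2/25 * norm a" "a \<noteq> 0"
  shows "usq u \<notin> \<real>\<^sub>\<le>\<^sub>0"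
proof -
  obtain w where w: "usq u = of_real ((norm a)\<^sup>2) * w" "cmod (w - 1) \<le> 1/6"
    using usq_relative[OF assms] by metis
  have "Re w \<ge> 5/6" using abs_Re_le_cmod[of "w - 1"] w(2) by simp
  then have "Re (usq u) > 0" using assms(2) by (simp add: w(1))
  then show ?thesis by (auto simp: complex_nonpos_Reals_iff)
qed

lemma usq_term:
  assumes "norm (u - cvec a) \<le> 2/25 * norm a" "a \<noteq> 0" "c \<ge> 0"
  shows "cmod (of_real c / usq u - of_real (c / (norm a)\<^sup>2)) \<le> c / (norm a)\<^sup>2 / 5"
proof -
  obtain w where w: "usq u = of_real ((norm a)\<^sup>2) * w" "cmod (w - 1) \<le> 1/6"
    using usq_relative[OF assms(1,2)] by metis
  have "of_real c / usq u - of_real (c / (norm a)\<^sup>2) = of_real (c / (norm a)\<^sup>2) * (1 / w - 1)"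
    by (simp add: w(1) divide_simps right_diff_distrib)
  then have "cmod (of_real c / usq u - of_real (c / (norm a)\<^sup>2)) = c / (norm a)\<^sup>2 * cmod (1 / w - 1)"
    using assms by (simp add: norm_mult norm_divide norm_power)
  also have "\<dots> \<le> c / (norm a)\<^sup>2 * (1/5)"
    using inverse_near_one[OF w(2)] assms by (intro mult_left_mono) auto
  finally show ?thesis by simp
qed

text \<open>The constant is \<open>(1 + 2/25) * (6/5) * (11/10)\<close>: the growth of the numerator and of the factors
  \<open>1 / w\<close> and \<open>1 / csqrt w\<close>.\<close>

lemma force_term:
  assumes "norm (u - cvec a) \<le> 2/25 * norm a" "a \<noteq> 0" "c \<ge> 0"
  shows "norm ((of_real c / usq u powr (3/2)) *s u) \<le> 891/625 * (c / (norm a)\<^sup>2)"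
proof -
  define r where "r = norm a"
  have r: "r > 0" using assms by (simp add: r_def)
  obtain w where w: "usq u = of_real (r\<^sup>2) * w" "cmod (w - 1) \<le> 1/6"
    using usq_relative[OF assms(1,2)] unfolding r_def by metis
  have uu: "cmod (usq u) \<ge> 5/6 * r\<^sup>2"
    using inverse_near_one(2)[OF w(2)] r by (simp add: w(1) norm_mult norm_power mult.commute)
  have "cmod (usq u powr (3/2)) = cmod (usq u) powr (3/2)"
    by (subst norm_powr_real_powr') (auto intro: Reals_divide)
  also have "\<dots> = cmod (usq u) powr (1 + 1/2)" by simp
  also have "\<dots> = cmod (usq u) * sqrt (cmod (usq u))"
    unfolding powr_add using uu r by (simp add: powr_half_sqrt)
  finally have p: "cmod (usq u powr (3/2)) = cmod (usq u) * sqrt (cmod (usq u))" .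
  have "10/11 * r \<le> sqrt (5/6 * r\<^sup>2)"
    using r by (intro real_le_rsqrt) (simp add: power2_eq_square)
  also have "\<dots> \<le> sqrt (cmod (usq u))" using uu by simp
  finally have sq: "10/11 * r \<le> sqrt (cmod (usq u))" .
  have "(5/6 * r\<^sup>2) * (10/11 * r) \<le> cmod (usq u powr (3/2))"
    unfolding p using uu sq r by (intro mult_mono) auto
  then have P: "cmod (usq u powr (3/2)) \<ge> 25/33 * r^3" by (simp add: power2_eq_square power3_eq_cube)
  have "norm u \<le> norm (u - cvec a) + norm (cvec a)" using norm_triangle_ineq[of "u - cvec a" "cvec a"] by simp
  then have nu: "norm u \<le> 27/25 * r" using assms by (simp add: r_def)
  have "norm ((of_real c / usq u powr (3/2)) *s u) = c * norm u / cmod (usq u powr (3/2))"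
    using assms by (simp add: norm_vector_smult norm_divide)
  also have "\<dots> \<le> c * (27/25 * r) / (25/33 * r^3)"
    using P nu assms r by (intro frac_le mult_left_mono) auto
  also have "\<dots> = 891/625 * (c / r\<^sup>2)" using r by (simp add: power2_eq_square power3_eq_cube)
  finally show ?thesis by (simp add: r_def)
qed



section \<open>Estimates on a complex tube around a real state\<close>

text \<open>The relative positions are measured in units of the mutual distances, and the velocities in units
  of \<open>s * K\<close>, which dominates \<open>s\<close> times the acceleration. No condition is put on the positions
  themselves, since the field depends on their differences only.\<close>

definition tube :: "real \<Rightarrow> ('n::{finite,linorder} \<Rightarrow> real) \<Rightarrow> (real, 'n) config \<Rightarrow> (real, 'n) config
    \<Rightarrow> real \<Rightarrow> real \<Rightarrow> ((complex, 'n) config \<times> (complex, 'n) config) set" where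
  "tube G m q0 v0 \<rho> \<mu> = {(q, v).
     (\<forall>i j. norm (q $ i - q $ j - cvec (q0 $ i - q0 $ j)) \<le> \<rho> * norm (q0 $ i - q0 $ j)) \<and>
     (\<forall>i. norm (v $ i - cvec (v0 $ i)) \<le> \<mu> * s G m q0 v0 * K G m q0 i)}"

context
  fixes G :: real and m :: "'n::{finite,linorder} \<Rightarrow> real" and q0 v0 :: "(real, 'n) config"
  assumes two: "CARD('n) \<ge> 2" and G: "G > 0" and m: "\<forall>i. m i > 0" and ncol: "q0 \<notin> collisions"
begin

lemma dist_pos: "i \<noteq> j \<Longrightarrow> norm (q0 $ i - q0 $ j) > 0"
  using ncol by (auto simp: collisions_def)

lemma K_real: "K G m q0 i = (\<Sum>k\<in>UNIV - {i}. G * m k / (norm (q0 $ i - q0 $ k))\<^sup>2)"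
  by (simp add: K_def usq_real)

lemma other_body: "\<exists>j::'n. j \<noteq> i"
proof (rule ccontr)
  assume "\<nexists>j. j \<noteq> i"
  then have "(UNIV :: 'n set) = {i}" by auto
  then have "CARD('n) = card {i}" by (rule arg_cong)
  with two show False by simp
qed

lemma K_pos: "K G m q0 i > 0"
proof -
  have "UNIV - {i} \<noteq> {}" using other_body by auto
  then show ?thesis unfolding K_real using G m
    by (intro sum_pos divide_pos_pos mult_pos_pos zero_less_power dist_pos) auto
qed

definition "vel_term = (\<lambda>(i,j). (norm (v0 $ i - v0 $ j))\<^sup>2 / (norm (q0 $ i - q0 $ j))\<^sup>2)"
definition "pot_term = (\<lambda>(i,j). (K G m q0 i + K G m q0 j) / norm (q0 $ i - q0 $ j))"

lemma s_base_real: "s_base G m q0 v0 = sum vel_term {(i,j). i < j} + sum pot_term {(i,j). i < j}"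
  unfolding s_base_def vel_term_def pot_term_def by (simp add: usq_real_powr_half) (simp add: usq_real)

lemma vel_term_nonneg: "vel_term p \<ge> 0" by (auto simp: vel_term_def split: prod.split)
lemma pot_term_nonneg: "pot_term p \<ge> 0"
  using K_pos[THEN less_imp_le] by (auto simp: pot_term_def split: prod.split)

lemma vel_term_le: "i < j \<Longrightarrow> vel_term (i,j) \<le> s_base G m q0 v0"
  unfolding s_base_real using member_le_sum[of "(i,j)" "{(i,j). i < j}" vel_term] sum_nonneg[of "{(i,j). i < j}" pot_term]
  by (simp add: vel_term_nonneg pot_term_nonneg)

lemma pot_term_le: "i < j \<Longrightarrow> pot_term (i,j) \<le> s_base G m q0 v0"
  unfolding s_base_real using member_le_sum[of "(i,j)" "{(i,j). i < j}" pot_term] sum_nonneg[of "{(i,j). i < j}" vel_term]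
  by (simp add: vel_term_nonneg pot_term_nonneg)

lemma s_base_pos: "s_base G m q0 v0 > 0"
proof -
  obtain i j :: 'n where "i < j" using other_body by (metis neqE)
  then have "0 < pot_term (i,j)"
    unfolding pot_term_def using K_pos dist_pos by (auto intro!: divide_pos_pos add_pos_pos)
  then show ?thesis using pot_term_le[OF \<open>i < j\<close>] by linarith
qed

lemma s_pos: "s G m q0 v0 > 0" using s_base_pos by (simp add: s_def)

lemma s_sq: "(s G m q0 v0)\<^sup>2 * s_base G m q0 v0 = 1"
proof -
  have "(s G m q0 v0)\<^sup>2 = s_base G m q0 v0 powr (-1)"
    unfolding s_def using s_base_pos by (simp add: powr_power)
  then show ?thesis using s_base_pos by (simp add: powr_minus)
qed

text \<open>Each summand of \<open>s_base\<close> is at most the sum, which is the inverse square of \<open>s\<close>. This and the next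
  lemma are the whole reason for the choice of \<open>s\<close>.\<close>

lemma s_vel_term: "i < j \<Longrightarrow> s G m q0 v0 * (norm (v0 $ i - v0 $ j) / norm (q0 $ i - q0 $ j)) \<le> 1"
proof -
  assume "i < j"
  then have "(s G m q0 v0)\<^sup>2 * vel_term (i,j) \<le> 1"
    using mult_left_mono[OF vel_term_le, of i j "(s G m q0 v0)\<^sup>2"] s_sq by simp
  then have "(s G m q0 v0 * (norm (v0 $ i - v0 $ j) / norm (q0 $ i - q0 $ j)))\<^sup>2 \<le> 1"
    by (simp add: vel_term_def power_mult_distrib power_divide)
  then show ?thesis using abs_square_le_1 abs_le_D1 by blast
qed

lemma s_pot_term: "i < j \<Longrightarrow> (s G m q0 v0)\<^sup>2 * pot_term (i,j) \<le> 1"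
  using mult_left_mono[OF pot_term_le, of i j "(s G m q0 v0)\<^sup>2"] s_sq by simp

lemma real_state_in_tube: "0 \<le> \<rho> \<Longrightarrow> 0 \<le> \<mu> \<Longrightarrow> (complexify q0, complexify v0) \<in> tube G m q0 v0 \<rho> \<mu>"
  using s_pos[THEN less_imp_le] K_pos[THEN less_imp_le] by (auto simp: tube_def complexify_nth cvec_diff)

context
  fixes q v :: "(complex, 'n) config"
  assumes qv: "(q, v) \<in> tube G m q0 v0 (2/25) (1/10)"
begin

lemma q_close: "norm (q $ i - q $ j - cvec (q0 $ i - q0 $ j)) \<le> 2/25 * norm (q0 $ i - q0 $ j)"
  using qv by (auto simp: tube_def)

lemma v_close: "norm (v $ i - v $ j - cvec (v0 $ i - v0 $ j)) \<le> 1/10 * s G m q0 v0 * (K G m q0 i + K G m q0 j)"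
proof -
  have "norm (v $ l - cvec (v0 $ l)) \<le> 1/10 * s G m q0 v0 * K G m q0 l" for l
    using qv by (auto simp: tube_def)
  then have "norm ((v $ i - cvec (v0 $ i)) - (v $ j - cvec (v0 $ j)))
      \<le> 1/10 * s G m q0 v0 * K G m q0 i + 1/10 * s G m q0 v0 * K G m q0 j"
    by (meson norm_triangle_ineq4 add_mono order_trans)
  then show ?thesis by (simp add: cvec_diff algebra_simps)
qed

lemma rel_ne: "i \<noteq> j \<Longrightarrow> q0 $ i - q0 $ j \<noteq> 0" using dist_pos[of i j] by auto

lemma usq_tube: "i \<noteq> j \<Longrightarrow> usq (q $ i - q $ j) \<notin> \<real>\<^sub>\<le>\<^sub>0"
  using usq_slit[OF q_close rel_ne] by simp

lemma K_tube: "cmod (K G m q i - of_real (K G m q0 i)) \<le> K G m q0 i / 5"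
proof -
  have "K G m q i - of_real (K G m q0 i) = (\<Sum>k\<in>UNIV - {i}. of_real (G * m k) / usq (q $ i - q $ k)
      - of_real (G * m k / (norm (q0 $ i - q0 $ k))\<^sup>2))"
    unfolding K_real unfolding K_def by (simp add: sum_subtractf)
  also have "cmod \<dots> \<le> (\<Sum>k\<in>UNIV - {i}. G * m k / (norm (q0 $ i - q0 $ k))\<^sup>2 / 5)"
    using G m by (intro sum_norm_le usq_term q_close rel_ne) (auto intro: mult_nonneg_nonneg less_imp_le)
  finally show ?thesis unfolding K_real by (simp add: sum_divide_distrib)
qed

text \<open>All summands of \<open>K\<close> are nonnegative at the real state, so their common relative error is also that of
  \<open>K\<close>, whatever the masses are. The root of the distance adds its own relative error.\<close>

lemma pot_term_tube:
  assumes "i < j"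
  shows "cmod ((K G m q i + K G m q j) / usq (q $ i - q $ j) powr (1/2) - of_real (pot_term (i,j))) \<le> 8/25 * pot_term (i,j)"
proof -
  define r where "r = norm (q0 $ i - q0 $ j)"
  have r: "r > 0" using dist_pos assms by (simp add: r_def)
  obtain w where w: "cmod (w - 1) \<le> 1/6" "usq (q $ i - q $ j) powr (1/2) = of_real r * csqrt w"
    using usq_relative[OF q_close rel_ne] assms unfolding r_def by (metis less_irrefl)
  have "cmod ((K G m q i - of_real (K G m q0 i)) + (K G m q j - of_real (K G m q0 j)))
      \<le> K G m q0 i / 5 + K G m q0 j / 5"
    by (intro norm_triangle_mono K_tube)
  then have "cmod ((K G m q i + K G m q j) - of_real (K G m q0 i + K G m q0 j)) \<le> (K G m q0 i + K G m q0 j) / 5"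
    by (simp add: algebra_simps add_divide_distrib)
  from near_one_mult[OF this csqrt_near_one[OF w(1)]]
  have "cmod ((K G m q i + K G m q j) * (1 / csqrt w) - of_real (K G m q0 i + K G m q0 j)) / r
      \<le> 8/25 * (K G m q0 i + K G m q0 j) / r"
    using r by (intro divide_right_mono) auto
  also have "cmod ((K G m q i + K G m q j) * (1 / csqrt w) - of_real (K G m q0 i + K G m q0 j)) / r
      = cmod (((K G m q i + K G m q j) * (1 / csqrt w) - of_real (K G m q0 i + K G m q0 j)) / of_real r)"
    using r by (simp add: norm_divide)
  also have "((K G m q i + K G m q j) * (1 / csqrt w) - of_real (K G m q0 i + K G m q0 j)) / of_real r
      = (K G m q i + K G m q j) / usq (q $ i - q $ j) powr (1/2) - of_real (pot_term (i,j))"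
    by (simp add: w(2) pot_term_def r_def[symmetric] diff_divide_distrib)
  finally show ?thesis by (simp add: pot_term_def r_def)
qed

text \<open>The real velocity term has a relative error of \<open>1/5\<close> from the denominator alone. Moving the
  velocities adds at most \<open>2 * V * d + d\<^sup>2\<close> to the numerator, where \<open>V\<close> is the real relative speed and
  \<open>d\<close> its change; this need not be small compared with \<open>V\<^sup>2\<close>, but it is small compared with the potential
  term of the same pair, to which it is charged.\<close>

lemma vel_term_tube:
  assumes "i < j"
  shows "cmod (usq (v $ i - v $ j) / usq (q $ i - q $ j) - of_real (vel_term (i,j))) \<le> 1/5 * vel_term (i,j) + 63/250 * pot_term (i,j)"
proof -
  define r where "r = norm (q0 $ i - q0 $ j)"
  have r: "r > 0" using dist_pos assms by (simp add: r_def)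
  define V where "V = norm (v0 $ i - v0 $ j)"
  define B where "B = pot_term (i,j)"
  define S where "S = s G m q0 v0"
  have B0: "B \<ge> 0" by (simp add: B_def pot_term_nonneg)
  have S0: "S > 0" by (simp add: S_def s_pos)
  have KB: "K G m q0 i + K G m q0 j = B * r" using r by (simp add: B_def pot_term_def r_def)
  obtain w where w: "usq (q $ i - q $ j) = of_real (r\<^sup>2) * w" "cmod (w - 1) \<le> 1/6"
    using usq_relative[OF q_close rel_ne] assms unfolding r_def by (metis less_irrefl)
  define d where "d = norm (v $ i - v $ j - cvec (v0 $ i - v0 $ j))"
  have d: "d \<le> 1/10 * S * (B * r)" using v_close[of i j] by (simp add: d_def S_def KB)
  have d0: "d \<ge> 0" by (simp add: d_def)
  define e where "e = usq (v $ i - v $ j) - of_real (V\<^sup>2)"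
  have "cmod e \<le> 2 * V * d + d\<^sup>2" unfolding e_def V_def d_def by (rule usq_perturb)
  also have "2 * V * d \<le> 2 * V * (1/10 * S * (B * r))" using d by (intro mult_left_mono) (auto simp: V_def)
  also have "\<dots> = 1/5 * (S * (V / r)) * (B * r\<^sup>2)" using r by (simp add: power2_eq_square)
  also have "\<dots> \<le> 1/5 * 1 * (B * r\<^sup>2)"
    using s_vel_term[OF assms] B0 by (intro mult_right_mono mult_left_mono) (auto simp: S_def V_def r_def)
  also have "d\<^sup>2 \<le> (1/10 * S * (B * r))\<^sup>2" using d d0 by (rule power_mono)
  also have "\<dots> = 1/100 * (S\<^sup>2 * B) * (B * r\<^sup>2)" by (simp add: power2_eq_square)
  also have "\<dots> \<le> 1/100 * 1 * (B * r\<^sup>2)"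
    using s_pot_term[OF assms] B0 by (intro mult_right_mono mult_left_mono) (auto simp: S_def B_def)
  finally have e: "cmod e \<le> 21/100 * (B * r\<^sup>2)" by simp
  have "cmod e / r\<^sup>2 * cmod (1 / w) \<le> (21/100 * B) * (6/5)"
    using e r B0 inverse_near_one(3)[OF w(2)] by (intro mult_mono) (auto simp: field_simps)
  then have t1: "cmod (e / of_real (r\<^sup>2) * (1 / w)) \<le> 63/250 * B"
    by (simp add: norm_mult norm_divide norm_power)
  have "V\<^sup>2 / r\<^sup>2 * cmod (1 / w - 1) \<le> V\<^sup>2 / r\<^sup>2 * (1/5)"
    using inverse_near_one(1)[OF w(2)] by (intro mult_left_mono) auto
  then have t2: "cmod (of_real (V\<^sup>2 / r\<^sup>2) * (1 / w - 1)) \<le> 1/5 * (V\<^sup>2 / r\<^sup>2)"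
    by (simp add: norm_mult norm_divide norm_power)
  have "usq (v $ i - v $ j) = of_real (V\<^sup>2) + e" by (simp add: e_def)
  then have "usq (v $ i - v $ j) / usq (q $ i - q $ j) - of_real (V\<^sup>2 / r\<^sup>2)
      = of_real (V\<^sup>2 / r\<^sup>2) * (1 / w - 1) + e / of_real (r\<^sup>2) * (1 / w)"
    by (simp add: w(1) add_divide_distrib right_diff_distrib)
  then show ?thesis
    using norm_triangle_mono[OF t2 t1] by (simp add: vel_term_def V_def r_def B_def)
qed

text \<open>The potential terms carry the larger total, \<open>63/250 + 8/25 = 143/250\<close>. As this is less than one,
  \<open>s_base\<close> stays in the right half plane.\<close>

lemma s_base_tube: "cmod (s_base G m q v - of_real (s_base G m q0 v0)) \<le> 143/250 * s_base G m q0 v0"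
proof -
  let ?P = "{(i,j). i < j} :: ('n \<times> 'n) set"
  define X where "X = (\<lambda>p. (case p of (i,j) \<Rightarrow> usq (v $ i - v $ j) / usq (q $ i - q $ j)) - of_real (vel_term p))"
  define Y where "Y = (\<lambda>p. (case p of (i,j) \<Rightarrow>
      (K G m q i + K G m q j) / usq (q $ i - q $ j) powr (1/2)) - of_real (pot_term p))"
  have eq: "s_base G m q v - of_real (s_base G m q0 v0) = sum X ?P + sum Y ?P"
    unfolding s_base_real unfolding s_base_def X_def Y_def by (simp add: sum_subtractf)
  have X: "cmod (sum X ?P) \<le> (\<Sum>p\<in>?P. 1/5 * vel_term p + 63/250 * pot_term p)"
    unfolding X_def by (rule sum_norm_le) (use vel_term_tube in auto)
  have Y: "cmod (sum Y ?P) \<le> (\<Sum>p\<in>?P. 8/25 * pot_term p)"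
    unfolding Y_def by (rule sum_norm_le) (use pot_term_tube in auto)
  have "cmod (sum X ?P + sum Y ?P) \<le> (\<Sum>p\<in>?P. 1/5 * vel_term p + 63/250 * pot_term p) + (\<Sum>p\<in>?P. 8/25 * pot_term p)"
    by (rule norm_triangle_mono[OF X Y])
  also have "\<dots> = 1/5 * sum vel_term ?P + 143/250 * sum pot_term ?P"
    unfolding sum.distrib sum_distrib_left[symmetric] by simp
  also have "\<dots> \<le> 143/250 * s_base G m q0 v0"
    unfolding s_base_real using sum_nonneg[of ?P vel_term] by (simp add: vel_term_nonneg)
  finally show ?thesis unfolding eq .
qed

lemma s_base_slit: "s_base G m q v \<notin> \<real>\<^sub>\<le>\<^sub>0"
  and s_base_lower: "cmod (s_base G m q v) \<ge> 107/250 * s_base G m q0 v0"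
proof -
  have "Re (s_base G m q v) \<ge> 107/250 * s_base G m q0 v0"
    using abs_Re_le_cmod[of "s_base G m q v - of_real (s_base G m q0 v0)"] s_base_tube by simp
  then show "cmod (s_base G m q v) \<ge> 107/250 * s_base G m q0 v0" "s_base G m q v \<notin> \<real>\<^sub>\<le>\<^sub>0"
    using complex_Re_le_cmod[of "s_base G m q v"] s_base_pos by (auto simp: complex_nonpos_Reals_iff)
qed

lemma tube_slit: "(q, v) \<in> slit_states G m"
  using usq_tube s_base_slit by (simp add: slit_states_def)

text \<open>Here \<open>153/100\<close> is an upper bound of \<open>(1 - 143/250) powr (-1/2)\<close>.\<close>

lemma s_tube: "cmod (s G m q v) \<le> 153/100 * s G m q0 v0"
proof -
  have "cmod (s G m q v) = cmod (s_base G m q v) powr (-1/2)"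
    unfolding s_def by (subst norm_powr_real_powr') (auto intro: Reals_divide)
  also have "\<dots> \<le> (107/250 * s_base G m q0 v0) powr (-1/2)"
    using s_base_lower s_base_pos by (intro powr_mono2') auto
  also have "\<dots> = (107/250) powr (-1/2) * s G m q0 v0"
    unfolding s_def by (rule powr_mult)
  also have "(107/250) powr (-1/2) = 1 / sqrt (107/250 :: real)"
    using powr_minus[of "107/250 :: real" "1/2"] by (simp add: powr_half_sqrt inverse_eq_divide)
  also have "\<dots> \<le> 153/100"
  proof -
    have "100/153 \<le> sqrt (107/250 :: real)" by (rule real_le_rsqrt) (simp add: power2_eq_square)
    then show ?thesis by (simp add: field_simps)
  qed
  finally show ?thesis using s_pos by (simp add: mult_right_mono)
qed

lemma accel_tube: "norm (accel G m q i) \<le> 891/625 * K G m q0 i"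
proof -
  have *: "norm (q $ j - q $ i - cvec (q0 $ j - q0 $ i)) \<le> 2/25 * norm (q0 $ i - q0 $ j)" for j
    using q_close[of j i] by (simp add: norm_minus_commute)
  have "norm (accel G m q i) \<le> (\<Sum>j\<in>UNIV - {i}. 891/625 * (G * m j / (norm (q0 $ i - q0 $ j))\<^sup>2))"
    unfolding accel_def
  proof (rule sum_norm_le)
    fix j assume j: "j \<in> UNIV - {i}"
    have "usq (q $ i - q $ j) = usq (q $ j - q $ i)" by (simp add: usq_def power2_commute)
    then show "norm ((of_real (G * m j) / usq (q $ i - q $ j) powr (3/2)) *s (q $ j - q $ i))
        \<le> 891/625 * (G * m j / (norm (q0 $ i - q0 $ j))\<^sup>2)"
      using force_term[OF q_close[of j i] rel_ne, of "G * m j"] j G m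
      by (auto simp: norm_minus_commute less_imp_le)
  qed
  then show ?thesis unfolding K_real by (simp add: sum_distrib_left)
qed

text \<open>This bounds the relative motion of a pair by its distance, so collisions cannot occur
  within a short fictitious time; \<open>1683/1000 = (153/100) * (1 + 1/10)\<close>.\<close>

lemma velocity_tube:
  assumes "i \<noteq> j"
  shows "norm (s G m q v *s (v $ i - v $ j)) \<le> 1683/1000 * norm (q0 $ i - q0 $ j)"
proof -
  have main: "norm (s G m q v *s (v $ i - v $ j)) \<le> 1683/1000 * norm (q0 $ i - q0 $ j)"
    if ij: "i < j" for i j
  proof -
    define r where "r = norm (q0 $ i - q0 $ j)"
    have r: "r > 0" using dist_pos ij by (simp add: r_def)
    define S where "S = s G m q0 v0"
    have S0: "S > 0" by (simp add: S_def s_pos)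
    have KB: "K G m q0 i + K G m q0 j = pot_term (i,j) * r" using r by (simp add: pot_term_def r_def)
    have "norm (v $ i - v $ j) \<le> norm (v0 $ i - v0 $ j) + 1/10 * S * (pot_term (i,j) * r)"
      using norm_triangle_sub[of "v $ i - v $ j" "cvec (v0 $ i - v0 $ j)"] v_close[of i j]
      by (simp add: KB S_def)
    then have "norm (s G m q v *s (v $ i - v $ j)) \<le> (153/100 * S) * (norm (v0 $ i - v0 $ j) + 1/10 * S * (pot_term (i,j) * r))"
      unfolding norm_vector_smult using s_tube S0 by (intro mult_mono) (auto simp: S_def)
    also have "\<dots> = 153/100 * (S * (norm (v0 $ i - v0 $ j) / r) + 1/10 * (S\<^sup>2 * pot_term (i,j))) * r"
      using r by (simp add: field_simps power2_eq_square)
    also have "\<dots> \<le> 153/100 * (1 + 1/10 * 1) * r"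
      using s_vel_term[OF ij] s_pot_term[OF ij] r by (intro mult_right_mono mult_left_mono add_mono) (auto simp: S_def r_def)
    finally show ?thesis by (simp add: r_def)
  qed
  show ?thesis
  proof (cases "i < j")
    case False
    then have "j < i" using assms by simp
    from main[OF this] show ?thesis
      by (simp add: norm_vector_smult norm_minus_commute)
  qed (rule main)
qed

text \<open>The product of the bounds \<open>153/100\<close> and \<open>891/625\<close>, rounded up.\<close>

lemma force_tube: "norm (s G m q v *s accel G m q i) \<le> 2727/1250 * s G m q0 v0 * K G m q0 i"
proof -
  have "norm (s G m q v *s accel G m q i) \<le> (153/100 * s G m q0 v0) * (891/625 * K G m q0 i)"
    unfolding norm_vector_smult using s_tube accel_tube s_pos by (intro mult_mono) auto
  also have "\<dots> \<le> 2727/1250 * s G m q0 v0 * K G m q0 i"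
    using s_pos K_pos[of i] by simp
  finally show ?thesis .
qed

end

end

section \<open>The vector field in scalar coordinates\<close>

definition qpart :: "(bool \<times> 'n::finite \<times> 3 \<Rightarrow> complex) \<Rightarrow> (complex, 'n) config" where
  "qpart x = (\<chi> i k. x (False, i, k))"

definition vpart :: "(bool \<times> 'n::finite \<times> 3 \<Rightarrow> complex) \<Rightarrow> (complex, 'n) config" where
  "vpart x = (\<chi> i k. x (True, i, k))"

definition pack :: "(complex, 'n::finite) config \<Rightarrow> (complex, 'n) config \<Rightarrow> bool \<times> 'n \<times> 3 \<Rightarrow> complex" where
  "pack q v = (\<lambda>(b, i, k). if b then v $ i $ k else q $ i $ k)"

definition vfield :: "real \<Rightarrow> ('n::{finite,linorder} \<Rightarrow> real) \<Rightarrow> (bool \<times> 'n \<times> 3 \<Rightarrow> complex) \<Rightarrow> bool \<times> 'n \<times> 3 \<Rightarrow> complex"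
  where "vfield G m x = (\<lambda>(b, i, k). s G m (qpart x) (vpart x) *
     (if b then accel G m (qpart x) i $ k else vpart x $ i $ k))"

lemma part_nth [simp]: "qpart x $ i $ k = x (False, i, k)" "vpart x $ i $ k = x (True, i, k)"
  by (simp_all add: qpart_def vpart_def)

lemma part_pack [simp]: "qpart (pack q v) = q" "vpart (pack q v) = v"
  by (simp_all add: pack_def vec_eq_iff)

lemma usq_holomorphic:
  assumes "\<And>k. (\<lambda>z. u z $ k) holomorphic_on S"
  shows "(\<lambda>z. usq (u z)) holomorphic_on S"
  unfolding usq_def by (intro holomorphic_intros assms)

lemma vfield_holomorphic:
  assumes hol: "\<And>p. (\<lambda>z. X z p) holomorphic_on S"
    and slit: "\<And>z. z \<in> S \<Longrightarrow> (qpart (X z), vpart (X z)) \<in> slit_states G m"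
  shows "(\<lambda>z. vfield G m (X z) p) holomorphic_on S"
proof -
  have u: "(\<lambda>z. usq (qpart (X z) $ i - qpart (X z) $ j)) holomorphic_on S" for i j
    by (rule usq_holomorphic) (auto intro!: holomorphic_intros hol)
  have uv: "(\<lambda>z. usq (vpart (X z) $ i - vpart (X z) $ j)) holomorphic_on S" for i j
    by (rule usq_holomorphic) (auto intro!: holomorphic_intros hol)
  have nz: "usq (qpart (X z) $ i - qpart (X z) $ j) \<notin> \<real>\<^sub>\<le>\<^sub>0" if "z \<in> S" "i \<noteq> j" for z i j
    using slit[OF that(1)] that(2) by (auto simp: slit_states_def)
  then have n0: "usq (qpart (X z) $ i - qpart (X z) $ j) \<noteq> 0" if "z \<in> S" "i \<noteq> j" for z i j
    using that by (metis complex_nonpos_Reals_iff order_refl zero_complex.sel)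
  have Kh: "(\<lambda>z. K G m (qpart (X z)) i) holomorphic_on S" for i
    unfolding K_def by (intro holomorphic_intros u) (metis n0 DiffD2 singletonI)
  have p: "(\<lambda>z. usq (qpart (X z) $ i - qpart (X z) $ j) powr a) holomorphic_on S" if "i \<noteq> j" for i j a
    by (intro holomorphic_intros u nz that)
  have pn: "usq (qpart (X z) $ i - qpart (X z) $ j) powr a \<noteq> 0" if "z \<in> S" "i \<noteq> j" for z i j a
    using n0[OF that] by simp
  have "(\<lambda>z. s_base G m (qpart (X z)) (vpart (X z))) holomorphic_on S"
    unfolding s_base_def split_def
    by (intro holomorphic_intros u uv Kh p) (auto simp: n0 pn)
  then have sh: "(\<lambda>z. s G m (qpart (X z)) (vpart (X z))) holomorphic_on S"
    unfolding s_def by (rule holomorphic_on_powr) (use slit in \<open>auto simp: slit_states_def\<close>)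
  have ah: "(\<lambda>z. accel G m (qpart (X z)) i $ k) holomorphic_on S" for i k
    unfolding accel_def
    by (simp, intro holomorphic_on_sum holomorphic_on_mult holomorphic_on_divide holomorphic_on_diff
        holomorphic_on_const p hol) (metis pn DiffD2 singletonI)+
  obtain b i k where "p = (b, i, k)" by (cases p)
  then show ?thesis
    unfolding vfield_def by (cases b) (auto intro!: holomorphic_intros sh ah hol)
qed

lemma of_real_powr_rat:
  assumes "x \<ge> 0"
  shows "complex_of_real x powr (1/2) = of_real (x powr (1/2))"
    "complex_of_real x powr (3/2) = of_real (x powr (3/2))"
    "complex_of_real x powr (-1/2) = of_real (x powr (-1/2))"
  using powr_of_real[OF assms, of "1/2"] powr_of_real[OF assms, of "3/2"] powr_of_real[OF assms, of "-1/2"]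
  by simp_all

lemma usq_complexify:
  "usq (complexify q $ i - complexify q $ j) = of_real (usq (q $ i - q $ j))"
  by (simp add: complexify_nth usq_real usq_cvec flip: cvec_diff)

lemma usq_nonneg: "usq (u :: real^3) \<ge> 0"
  by (simp add: usq_real)

lemma K_complexify: "K G m (complexify q) i = of_real (K G m q i)"
  by (simp add: K_def usq_complexify)

lemma s_base_complexify: "s_base G m (complexify q) (complexify v) = of_real (s_base G m q v)"
  unfolding s_base_def usq_complexify K_complexify of_real_powr_rat(1)[OF usq_nonneg] split_def
  by simp

lemma s_base_nonneg:
  fixes q v :: "(real, 'n::{finite,linorder}) config"
  assumes "G > 0" "\<forall>i. m i > 0"
  shows "s_base G m q v \<ge> 0"
proof -
  have "K G m q i \<ge> 0" for i
    unfolding K_def using assms by (intro sum_nonneg divide_nonneg_nonneg usq_nonneg) (simp add: less_imp_le)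
  then show ?thesis unfolding s_base_def
    by (intro add_nonneg_nonneg sum_nonneg) (auto intro!: divide_nonneg_nonneg usq_nonneg)
qed

lemma s_complexify:
  fixes q v :: "(real, 'n::{finite,linorder}) config"
  assumes "G > 0" "\<forall>i. m i > 0"
  shows "s G m (complexify q) (complexify v) = of_real (s G m q v)"
  unfolding s_def s_base_complexify by (rule of_real_powr_rat(3)[OF s_base_nonneg[OF assms]])

lemma accel_complexify: "accel G m (complexify q) i $ k = of_real (accel G m q i $ k)"
  unfolding accel_def usq_complexify of_real_powr_rat(2)[OF usq_nonneg]
  by (simp add: complexify_nth)

lemma vfield_complexify:
  fixes q v :: "(real, 'n::{finite,linorder}) config"
  assumes "G > 0" "\<forall>i. m i > 0"
  shows "vfield G m (pack (complexify q) (complexify v)) (b, i, k) =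
    of_real (s G m q v * (if b then accel G m q i $ k else v $ i $ k))"
  using s_complexify[OF assms] by (simp add: vfield_def accel_complexify) (simp add: pack_def complexify_nth)

definition real_part :: "(complex, 'n::finite) config \<Rightarrow> (real, 'n) config" where
  "real_part q = (\<chi> i k. Re (q $ i $ k))"

lemma real_part_complexify [simp]: "real_part (complexify q) = q"
  by (simp add: real_part_def complexify_nth vec_eq_iff)

lemma real_state:
  assumes "\<And>p. x p \<in> \<real>"
  shows "x = pack (complexify (real_part (qpart x))) (complexify (real_part (vpart x)))"
  using assms by (auto simp: pack_def fun_eq_iff complexify_nth real_part_def of_real_Re)

lemma vfield_Reals:
  assumes "G > 0" "\<forall>i. m i > 0" "\<And>p. x p \<in> \<real>"
  shows "vfield G m x p \<in> \<real>"
proof -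
  obtain b i k where "p = (b, i, k)" by (cases p)
  then show ?thesis
    by (subst real_state[OF assms(3)]) (simp add: vfield_complexify[OF assms(1,2)])
qed

section \<open>The solution on a disk of radius \<open>\<beta>\<close>\<close>

lemma beta_pos: "\<beta> > 0" by (simp add: \<beta>_def)

text \<open>For vectors the mean value inequality in the Hermitian norm follows from the scalar one, applied to
  the component of \<open>f\<close> in the direction of \<open>f z - f 0\<close>.\<close>

lemma vec_mean_value:
  fixes f g :: "complex \<Rightarrow> complex^3"
  assumes d: "\<And>z k. z \<in> ball 0 R \<Longrightarrow> ((\<lambda>z. f z $ k) has_field_derivative g z $ k) (at z)"
    and b: "\<And>z. z \<in> ball 0 R \<Longrightarrow> norm (g z) \<le> C"
    and z: "z \<in> ball 0 R"
  shows "norm (f z - f 0) \<le> C * norm z"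
proof -
  define e where "e = f z - f 0"
  define c where "c = (\<chi> k. cnj (e $ k))"
  have nc: "norm c = norm e" by (simp add: c_def norm_vec_def)
  have z0: "0 \<in> ball 0 R" using z by (auto intro: le_less_trans[OF norm_ge_zero])
  have "norm ((\<Sum>k\<in>UNIV. c $ k * f z $ k) - (\<Sum>k\<in>UNIV. c $ k * f 0 $ k)) \<le> (norm e * C) * norm (z - 0)"
  proof (rule field_differentiable_bound[where S = "ball 0 R" and f' = "\<lambda>z. \<Sum>k\<in>UNIV. c $ k * g z $ k"])
    fix w :: complex assume w: "w \<in> ball 0 R"
    show "((\<lambda>z. \<Sum>k\<in>UNIV. c $ k * f z $ k) has_field_derivative (\<Sum>k\<in>UNIV. c $ k * g w $ k)) (at w within ball 0 R)"
      by (rule has_field_derivative_at_within) (intro DERIV_sum DERIV_cmult d w)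
    have "cmod (\<Sum>k\<in>UNIV. c $ k * g w $ k) \<le> norm c * norm (g w)" by (rule norm_inner_le)
    also have "\<dots> \<le> norm e * C" unfolding nc using b[OF w] by (intro mult_left_mono) auto
    finally show "cmod (\<Sum>k\<in>UNIV. c $ k * g w $ k) \<le> norm e * C" .
  qed (use z z0 in auto)
  moreover have "c $ k * f z $ k - c $ k * f 0 $ k = of_real ((cmod (e $ k))\<^sup>2)" for k
    unfolding right_diff_distrib[symmetric] complex_norm_square by (simp add: c_def e_def)
  then have "(\<Sum>k\<in>UNIV. c $ k * f z $ k) - (\<Sum>k\<in>UNIV. c $ k * f 0 $ k) = of_real ((norm e)\<^sup>2)"
    unfolding norm_sq_complex3 sum_subtractf[symmetric] of_real_sum by simp
  ultimately have "norm e * norm e \<le> norm e * (C * norm z)"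
    by (simp add: power2_eq_square mult_ac norm_mult)
  then show ?thesis
    by (cases "e = 0") (auto simp: e_def intro!: mult_nonneg_nonneg order_trans[OF norm_ge_zero b[OF z]])
qed

lemma segment_close:
  fixes u w a :: "complex^3"
  assumes "norm (u - a) \<le> c" "norm (w - a) \<le> c" "0 \<le> t" "t \<le> 1"
  shows "norm (u + t *\<^sub>R (w - u) - a) \<le> c"
proof -
  have "(1 - t) *\<^sub>R u + t *\<^sub>R w \<in> cball a c"
    using assms by (intro convexD_alt convex_cball) (auto simp: dist_norm norm_minus_commute)
  moreover have "u + t *\<^sub>R (w - u) = (1 - t) *\<^sub>R u + t *\<^sub>R w" by (simp add: algebra_simps)
  ultimately show ?thesis by (simp add: dist_norm norm_minus_commute)
qed

lemma norm_part_le: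
  "norm (qpart x $ i - qpart y $ i) \<le> (\<Sum>p\<in>UNIV. cmod (x p - y p))"
  "norm (vpart x $ i - vpart y $ i) \<le> (\<Sum>p\<in>UNIV. cmod (x p - y p))"
proof -
  have *: "(\<Sum>k\<in>UNIV. cmod (x (b, i, k) - y (b, i, k))) \<le> (\<Sum>p\<in>UNIV. cmod (x p - y p))" for b
  proof -
    have "(\<Sum>k\<in>UNIV. cmod (x (b, i, k) - y (b, i, k))) = (\<Sum>p\<in>(\<lambda>k. (b, i, k)) ` UNIV. cmod (x p - y p))"
      by (subst sum.reindex) (auto simp: inj_on_def)
    also have "\<dots> \<le> (\<Sum>p\<in>UNIV. cmod (x p - y p))" by (rule sum_mono2) auto
    finally show ?thesis .
  qed
  have "norm u \<le> (\<Sum>k\<in>UNIV. cmod (u $ k))" for u :: "complex^3"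
    unfolding norm_vec_def by (rule L2_set_le_sum) auto
  then show "norm (qpart x $ i - qpart y $ i) \<le> (\<Sum>p\<in>UNIV. cmod (x p - y p))"
    "norm (vpart x $ i - vpart y $ i) \<le> (\<Sum>p\<in>UNIV. cmod (x p - y p))"
    by (rule order_trans, simp add: *)+
qed

context
  fixes G :: real and m :: "'n::{finite,linorder} \<Rightarrow> real" and q0 v0 :: "(real, 'n) config"
  assumes two: "CARD('n) \<ge> 2" and G: "G > 0" and m: "\<forall>i. m i > 0" and ncol: "q0 \<notin> collisions"
begin

text \<open>The solution stays in the inner tube. The outer one, on which the estimates hold, leaves the room that
  Cauchy's inequality needs.\<close>

definition "inner_tube = {x. (qpart x, vpart x) \<in> tube G m q0 v0 (3/40) (97/1000)}"
definition "outer_tube = {x. (qpart x, vpart x) \<in> tube G m q0 v0 (2/25) (1/10)}"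

lemmas state_assms = two G m ncol

lemma tube_consts: "(3/40 :: real) \<le> 2/25" "(97/1000 :: real) \<le> 1/10" by simp_all

lemma inner_tube_subset: "x \<in> inner_tube \<Longrightarrow> (qpart x, vpart x) \<in> tube G m q0 v0 (2/25) (1/10)"
proof -
  assume "x \<in> inner_tube"
  moreover have "\<rho> * a \<le> \<rho>' * a" if "\<rho> \<le> \<rho>'" "a \<ge> 0" for \<rho> \<rho>' a :: real
    using that by (rule mult_right_mono)
  moreover have "s G m q0 v0 * K G m q0 i \<ge> 0" for i
    using s_pos[OF state_assms, of v0] K_pos[OF state_assms, of i] by simp
  ultimately show ?thesis
    unfolding inner_tube_def tube_def mem_Collect_eq split_conv mult.assoc
    by (meson divide_le_eq_1 norm_ge_zero order_trans tube_consts)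
qed

text \<open>Every defining condition is a bound on the norm of an affine function of the state.\<close>

lemma inner_tube_segment:
  assumes "x \<in> inner_tube" "y \<in> inner_tube" "0 \<le> t" "t \<le> 1"
  shows "(\<lambda>j. x j + of_real t * (y j - x j)) \<in> inner_tube"
proof -
  let ?z = "\<lambda>j. x j + of_real t * (y j - x j)"
  have q: "qpart ?z $ i - qpart ?z $ j = (qpart x $ i - qpart x $ j)
      + t *\<^sub>R ((qpart y $ i - qpart y $ j) - (qpart x $ i - qpart x $ j))" for i j
    by (simp add: vec_eq_iff algebra_simps scaleR_conv_of_real[where 'a = complex])
  have v: "vpart ?z $ i = vpart x $ i + t *\<^sub>R (vpart y $ i - vpart x $ i)" for i
    by (simp add: vec_eq_iff algebra_simps scaleR_conv_of_real[where 'a = complex])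
  show ?thesis using assms unfolding inner_tube_def tube_def
    by (auto simp only: mem_Collect_eq split_conv q v intro!: segment_close)
qed

text \<open>The gaps between the two tubes are \<open>2/25 - 3/40 = 1/200\<close> and \<open>1/10 - 97/1000 = 3/1000\<close> in their
  natural units. A relative position involves two bodies, hence the denominator \<open>400\<close> in the proof.\<close>

lemma tube_room:
  obtains \<delta> where "\<delta> > 0"
    "\<And>x y. x \<in> inner_tube \<Longrightarrow> (\<Sum>p\<in>UNIV. cmod (y p - x p)) \<le> \<delta> \<Longrightarrow> y \<in> outer_tube"
    "\<And>y. (\<And>p. cmod (y p - pack (complexify q0) (complexify v0) p) \<le> \<delta>) \<Longrightarrow> y \<in> inner_tube"
proof -
  define E where "E = insert 1 ((\<lambda>(i, j). norm (q0 $ i - q0 $ j) / 400) ` {(i, j). i \<noteq> j}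
      \<union> range (\<lambda>i. 3/1000 * s G m q0 v0 * K G m q0 i))"
  have finE: "finite E" by (simp add: E_def)
  have posE: "\<forall>e\<in>E. e > 0"
    using s_pos[OF state_assms, of v0] K_pos[OF state_assms] dist_pos[OF state_assms] by (auto simp: E_def)
  define \<epsilon> where "\<epsilon> = Min E"
  have \<epsilon>: "\<epsilon> > 0" using finE posE by (auto simp: \<epsilon>_def E_def)
  have eq: "\<epsilon> \<le> norm (q0 $ i - q0 $ j) / 400" if "i \<noteq> j" for i j
    unfolding \<epsilon>_def using finE that by (intro Min_le) (auto simp: E_def)
  have ev: "\<epsilon> \<le> 3/1000 * s G m q0 v0 * K G m q0 i" for i
    unfolding \<epsilon>_def using finE by (intro Min_le) (auto simp: E_def)
  define N where "N = real CARD(bool \<times> 'n \<times> 3)"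
  have N: "N \<ge> 1" unfolding N_def using one_le_card_finite[where 'a = "bool \<times> 'n \<times> 3"] by (simp only: of_nat_1 of_nat_le_iff[symmetric])
  have diff: "norm (qpart y $ i - qpart y $ j - (qpart x $ i - qpart x $ j)) \<le> 1/200 * norm (q0 $ i - q0 $ j)"
    "norm (vpart y $ i - vpart x $ i) \<le> 3/1000 * s G m q0 v0 * K G m q0 i"
    if "(\<Sum>p\<in>UNIV. cmod (y p - x p)) \<le> \<epsilon>" for x y i j
  proof -
    show "norm (qpart y $ i - qpart y $ j - (qpart x $ i - qpart x $ j)) \<le> 1/200 * norm (q0 $ i - q0 $ j)"
    proof (cases "i = j")
      case False
      have "norm ((qpart y $ i - qpart x $ i) - (qpart y $ j - qpart x $ j)) \<le> \<epsilon> + \<epsilon>"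
        using norm_part_le(1)[of y _ x] that by (meson norm_triangle_ineq4 add_mono order_trans)
      then show ?thesis using eq[OF False] by (simp add: algebra_simps)
    qed simp
    show "norm (vpart y $ i - vpart x $ i) \<le> 3/1000 * s G m q0 v0 * K G m q0 i"
      using norm_part_le(2)[of y i x] that ev[of i] by linarith
  qed
  have tri: "norm (u - a) \<le> c + d" if "norm (w - a) \<le> c" "norm (u - w) \<le> d" for u w a :: "complex^3" and c d
    using norm_triangle_mono[OF that] by (simp add: algebra_simps)
  show thesis
  proof (rule that[of "\<epsilon> / N"])
    show "\<epsilon> / N > 0" using \<epsilon> N by simp
    have le: "\<epsilon> / N \<le> \<epsilon>" using \<epsilon> N by (simp add: field_simps)
    fix x y :: "bool \<times> 'n \<times> 3 \<Rightarrow> complex"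
    assume x: "x \<in> inner_tube" and "(\<Sum>p\<in>UNIV. cmod (y p - x p)) \<le> \<epsilon> / N"
    then have y: "(\<Sum>p\<in>UNIV. cmod (y p - x p)) \<le> \<epsilon>" using le by linarith
    show "y \<in> outer_tube" unfolding outer_tube_def tube_def
    proof (simp only: mem_Collect_eq split_conv, intro conjI allI)
      fix i j
      have "norm (qpart x $ i - qpart x $ j - cvec (q0 $ i - q0 $ j)) \<le> 3/40 * norm (q0 $ i - q0 $ j)"
        using x by (auto simp: inner_tube_def tube_def)
      from tri[OF this diff(1)[OF y]] show "norm (qpart y $ i - qpart y $ j - cvec (q0 $ i - q0 $ j)) \<le> 2/25 * norm (q0 $ i - q0 $ j)"
        by simp
      have "norm (vpart x $ i - cvec (v0 $ i)) \<le> 97/1000 * s G m q0 v0 * K G m q0 i"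
        using x by (auto simp: inner_tube_def tube_def)
      from tri[OF this diff(2)[OF y]] show "norm (vpart y $ i - cvec (v0 $ i)) \<le> 1/10 * s G m q0 v0 * K G m q0 i"
        by (simp add: mult_ac)
    qed
  next
    fix y
    define x where "x = pack (complexify q0) (complexify v0)"
    assume "\<And>p. cmod (y p - pack (complexify q0) (complexify v0) p) \<le> \<epsilon> / N"
    then have "(\<Sum>p\<in>UNIV. cmod (y p - x p)) \<le> N * (\<epsilon> / N)"
      unfolding N_def x_def by (intro sum_bounded_above) auto
    then have y: "(\<Sum>p\<in>UNIV. cmod (y p - x p)) \<le> \<epsilon>" using N by simp
    show "y \<in> inner_tube" unfolding inner_tube_def tube_def
    proof (simp only: mem_Collect_eq split_conv, intro conjI allI)
      fix i j
      have "norm (qpart y $ i - qpart y $ j - cvec (q0 $ i - q0 $ j)) \<le> 1/200 * norm (q0 $ i - q0 $ j)"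
        using diff(1)[OF y, of i j] by (simp add: x_def complexify_nth cvec_diff)
      then show "norm (qpart y $ i - qpart y $ j - cvec (q0 $ i - q0 $ j)) \<le> 3/40 * norm (q0 $ i - q0 $ j)"
        by (rule order_trans) simp
      have "norm (vpart y $ i - cvec (v0 $ i)) \<le> 3/1000 * s G m q0 v0 * K G m q0 i"
        using diff(2)[OF y, of i] by (simp add: x_def complexify_nth)
      then show "norm (vpart y $ i - cvec (v0 $ i)) \<le> 97/1000 * s G m q0 v0 * K G m q0 i"
        by (rule order_trans) (use s_pos[OF state_assms, of v0] K_pos[OF state_assms, of i] in \<open>intro mult_right_mono, auto\<close>)
    qed
  qed
qed

lemma vfield_bounded: "\<exists>M. \<forall>x\<in>outer_tube. \<forall>p. cmod (vfield G m x p) \<le> M"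
proof -
  define b where "b = (\<lambda>i. 153/100 * s G m q0 v0 * (norm (v0 $ i) + 1/10 * s G m q0 v0 * K G m q0 i)
      + 2727/1250 * s G m q0 v0 * K G m q0 i)"
  have sp: "s G m q0 v0 > 0" and Kp: "K G m q0 i > 0" for i by (rule s_pos[OF state_assms] K_pos[OF state_assms])+
  have b0: "b i \<ge> 0" for i
    using sp Kp[of i] by (auto simp: b_def intro!: add_nonneg_nonneg mult_nonneg_nonneg)
  have "cmod (vfield G m x (c, i, k)) \<le> sum b UNIV" if "x \<in> outer_tube" for x c i k
  proof -
    have x: "(qpart x, vpart x) \<in> tube G m q0 v0 (2/25) (1/10)" using that by (simp add: outer_tube_def)
    have "norm (s G m (qpart x) (vpart x) *s accel G m (qpart x) i) \<le> b i"
      by (rule order_trans[OF force_tube[OF state_assms x]])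
        (use sp Kp[of i] in \<open>auto simp: b_def intro!: mult_nonneg_nonneg add_nonneg_nonneg\<close>)
    moreover have "norm (s G m (qpart x) (vpart x) *s vpart x $ i) \<le> b i"
    proof -
      have "norm (vpart x $ i - cvec (v0 $ i)) \<le> 1/10 * s G m q0 v0 * K G m q0 i"
        using x by (auto simp: tube_def)
      then have "norm (vpart x $ i) \<le> norm (v0 $ i) + 1/10 * s G m q0 v0 * K G m q0 i"
        using norm_triangle_sub[of "vpart x $ i" "cvec (v0 $ i)"] by simp
      then have "norm (s G m (qpart x) (vpart x) *s vpart x $ i) \<le>
          153/100 * s G m q0 v0 * (norm (v0 $ i) + 1/10 * s G m q0 v0 * K G m q0 i)"
        unfolding norm_vector_smult using s_tube[OF state_assms x] sp by (intro mult_mono) auto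
      also have "\<dots> \<le> b i" using sp Kp[of i] by (simp add: b_def)
      finally show ?thesis .
    qed
    ultimately have "cmod (vfield G m x (c, i, k)) \<le> b i"
      using Finite_Cartesian_Product.norm_nth_le[where x = "s G m (qpart x) (vpart x) *s accel G m (qpart x) i" and i = k]
        Finite_Cartesian_Product.norm_nth_le[where x = "s G m (qpart x) (vpart x) *s vpart x $ i" and i = k]
      by (auto simp: vfield_def)
    also have "b i \<le> sum b UNIV" by (rule member_le_sum) (auto simp: b0)
    finally show ?thesis .
  qed
  then show ?thesis by (intro exI[of _ "sum b UNIV"]) auto
qed

lemma vfield_lipschitz:
  "\<exists>L. \<forall>x\<in>inner_tube. \<forall>y\<in>inner_tube. \<forall>p. cmod (vfield G m x p - vfield G m y p) \<le> L * (\<Sum>p\<in>UNIV. cmod (x p - y p))"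
proof -
  obtain \<delta> where d: "\<delta> > 0"
    "\<And>x y. x \<in> inner_tube \<Longrightarrow> (\<Sum>p\<in>UNIV. cmod (y p - x p)) \<le> \<delta> \<Longrightarrow> y \<in> outer_tube"
    by (rule tube_room) blast
  obtain M where M: "\<And>x p. x \<in> outer_tube \<Longrightarrow> cmod (vfield G m x p) \<le> M"
    using vfield_bounded by blast
  have "cmod (vfield G m x p - vfield G m y p) \<le> 2 * M / \<delta> * (\<Sum>p\<in>UNIV. cmod (x p - y p))"
    if "x \<in> inner_tube" "y \<in> inner_tube" for x y p
  proof (rule cauchy_lipschitz[where D = inner_tube and D' = outer_tube])
    fix x h :: "bool \<times> 'n \<times> 3 \<Rightarrow> complex" and S
    assume "\<And>z. z \<in> S \<Longrightarrow> (\<lambda>j. x j + z * h j) \<in> outer_tube"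
    then show "(\<lambda>z. vfield G m (\<lambda>j. x j + z * h j) p) holomorphic_on S"
      by (intro vfield_holomorphic holomorphic_intros tube_slit[OF state_assms, of _ _ v0]) (auto simp: outer_tube_def)
  qed (use that d M inner_tube_segment in auto)
  then show ?thesis by blast
qed

text \<open>Here the value of \<open>\<beta>\<close> enters, through \<open>\<beta> * 1683/1000 \<le> 3/40\<close> and \<open>\<beta> * 2727/1250 \<le> 97/1000\<close>: a Picard
  iterate moves within the disk by no more than the width of the inner tube.\<close>

lemma local_solution:
  obtains X where "X 0 = pack (complexify q0) (complexify v0)"
    "\<And>z p. z \<in> ball 0 \<beta> \<Longrightarrow> ((\<lambda>z. X z p) has_field_derivative vfield G m (X z) p) (at z)"
    "\<And>z. z \<in> ball 0 \<beta> \<Longrightarrow> (qpart (X z), vpart (X z)) \<in> slit_states G m"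
    "\<And>t p. \<bar>t\<bar> < \<beta> \<Longrightarrow> X (of_real t) p \<in> \<real>"
proof -
  define x0 where "x0 = pack (complexify q0) (complexify v0)"
  have x0_real: "x0 p \<in> \<real>" for p by (cases p) (auto simp: x0_def pack_def complexify_nth)
  define A where "A = (\<lambda>X. (\<forall>z\<in>ball 0 \<beta>. X z \<in> inner_tube) \<and> (\<forall>t p. \<bar>t\<bar> < \<beta> \<longrightarrow> X (complex_of_real t) p \<in> \<real>))"
  obtain L where L: "\<And>x y p. x \<in> inner_tube \<Longrightarrow> y \<in> inner_tube \<Longrightarrow>
      cmod (vfield G m x p - vfield G m y p) \<le> L * (\<Sum>p\<in>UNIV. cmod (x p - y p))"
    using vfield_lipschitz by blast
  obtain X where X: "A X" "X 0 = x0"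
    "\<And>z p. z \<in> ball 0 \<beta> \<Longrightarrow> ((\<lambda>z. X z p) has_field_derivative vfield G m (X z) p) (at z)"
  proof (rule picard_ball[where R = \<beta> and F = "vfield G m" and A = A and D = inner_tube and L = L and ?x0.0 = x0])
    show "A (\<lambda>z. x0)" using x0_real real_state_in_tube[OF state_assms] by (simp add: A_def inner_tube_def x0_def)
  next
    fix X Y assume AX: "A X" and Y0: "Y 0 = x0"
      and dY: "\<And>z p. z \<in> ball 0 \<beta> \<Longrightarrow> ((\<lambda>z. Y z p) has_field_derivative vfield G m (X z) p) (at z)"
    have tX: "(qpart (X z), vpart (X z)) \<in> tube G m q0 v0 (2/25) (1/10)" if "z \<in> ball 0 \<beta>" for z
      using AX that inner_tube_subset by (simp add: A_def)
    have "Y z \<in> inner_tube" if z: "z \<in> ball 0 \<beta>" for z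
      unfolding inner_tube_def tube_def
    proof (simp only: mem_Collect_eq split_conv, intro conjI allI)
      fix i j
      show "norm (qpart (Y z) $ i - qpart (Y z) $ j - cvec (q0 $ i - q0 $ j)) \<le> 3/40 * norm (q0 $ i - q0 $ j)"
      proof (cases "i = j")
        case False
        have "norm (qpart (Y z) $ i - qpart (Y z) $ j - (qpart (Y 0) $ i - qpart (Y 0) $ j))
            \<le> (1683/1000 * norm (q0 $ i - q0 $ j)) * norm z"
        proof (rule vec_mean_value[OF _ _ z, where f = "\<lambda>z. qpart (Y z) $ i - qpart (Y z) $ j"
              and g = "\<lambda>w. s G m (qpart (X w)) (vpart (X w)) *s (vpart (X w) $ i - vpart (X w) $ j)"])
          fix w :: complex and k assume w: "w \<in> ball 0 \<beta>"
          show "((\<lambda>z. (qpart (Y z) $ i - qpart (Y z) $ j) $ k) has_field_derivative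
              (s G m (qpart (X w)) (vpart (X w)) *s (vpart (X w) $ i - vpart (X w) $ j)) $ k) (at w)"
            using DERIV_diff[OF dY[OF w, of "(False, i, k)"] dY[OF w, of "(False, j, k)"]]
            by (simp add: vfield_def right_diff_distrib)
        qed (rule velocity_tube[OF state_assms tX False])
        also have "\<dots> \<le> (1683/1000 * norm (q0 $ i - q0 $ j)) * \<beta>"
          using z by (intro mult_left_mono) auto
        also have "\<dots> \<le> 3/40 * norm (q0 $ i - q0 $ j)" by (simp add: \<beta>_def)
        finally show ?thesis by (simp add: Y0 x0_def complexify_nth cvec_diff)
      qed simp
      have "norm (vpart (Y z) $ i - vpart (Y 0) $ i) \<le> (2727/1250 * s G m q0 v0 * K G m q0 i) * norm z"
      proof (rule vec_mean_value[OF _ _ z, where f = "\<lambda>z. vpart (Y z) $ i"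
            and g = "\<lambda>w. s G m (qpart (X w)) (vpart (X w)) *s accel G m (qpart (X w)) i"])
        fix w :: complex and k assume w: "w \<in> ball 0 \<beta>"
        show "((\<lambda>z. vpart (Y z) $ i $ k) has_field_derivative
            (s G m (qpart (X w)) (vpart (X w)) *s accel G m (qpart (X w)) i) $ k) (at w)"
          using dY[OF w, of "(True, i, k)"] by (simp add: vfield_def)
      qed (rule force_tube[OF state_assms tX])
      also have "\<dots> \<le> (2727/1250 * s G m q0 v0 * K G m q0 i) * \<beta>"
        using z s_pos[OF state_assms, of v0] K_pos[OF state_assms, of i] by (intro mult_left_mono) auto
      also have "\<dots> \<le> 97/1000 * s G m q0 v0 * K G m q0 i"
        using s_pos[OF state_assms, of v0] K_pos[OF state_assms, of i] by (simp add: \<beta>_def)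
      finally show "norm (vpart (Y z) $ i - cvec (v0 $ i)) \<le> 97/1000 * s G m q0 v0 * K G m q0 i"
        by (simp add: Y0 x0_def complexify_nth)
    qed
    moreover have "Y (of_real t) p \<in> \<real>" if t: "\<bar>t\<bar> < \<beta>" for t p
    proof -
      have d: "((\<lambda>r. Im (Y (of_real r) p)) has_real_derivative 0) (at r)" if r: "\<bar>r\<bar> < \<beta>" for r
      proof -
        have "of_real r \<in> ball (0::complex) \<beta>" using r by simp
        from has_vector_derivative_real_field[OF dY[OF this, of p]]
        have "((\<lambda>r. Im (Y (of_real r) p)) has_vector_derivative Im (vfield G m (X (of_real r)) p)) (at r)"
          by (rule bounded_linear.has_vector_derivative[OF bounded_linear_Im])
        moreover have "vfield G m (X (of_real r)) p \<in> \<real>"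
          using AX r unfolding A_def by (intro vfield_Reals G m) blast
        ultimately show ?thesis
          by (simp add: has_real_derivative_iff_has_vector_derivative complex_is_Real_iff)
      qed
      have "\<exists>c. \<forall>r\<in>ball 0 \<beta>. Im (Y (of_real r) p) = c"
        by (rule has_field_derivative_zero_constant) (auto intro!: has_field_derivative_at_within d)
      then have "Im (Y (of_real t) p) = Im (Y (of_real 0) p)"
        using t beta_pos by (auto simp del: of_real_0)
      then show ?thesis using x0_real[of p] by (simp add: Y0 complex_is_Real_iff)
    qed
    ultimately show "A Y" by (simp add: A_def)
  next
    fix Xs X assume AX: "\<And>n. A (Xs n)"
      and lim: "\<And>z p. z \<in> ball 0 \<beta> \<Longrightarrow> (\<lambda>n. Xs n z p) \<longlonglongrightarrow> X z p"
    have "X z \<in> inner_tube" if z: "z \<in> ball 0 \<beta>" for z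
    proof -
      have q: "(\<lambda>n. qpart (Xs n z) $ i) \<longlonglongrightarrow> qpart (X z) $ i" for i
        by (rule vec_tendstoI) (simp add: lim[OF z])
      have v: "(\<lambda>n. vpart (Xs n z) $ i) \<longlonglongrightarrow> vpart (X z) $ i" for i
        by (rule vec_tendstoI) (simp add: lim[OF z])
      have tb: "Xs n z \<in> inner_tube" for n using AX z by (simp add: A_def)
      show ?thesis unfolding inner_tube_def tube_def
      proof (simp only: mem_Collect_eq split_conv, intro conjI allI)
        fix i j
        show "norm (qpart (X z) $ i - qpart (X z) $ j - cvec (q0 $ i - q0 $ j)) \<le> 3/40 * norm (q0 $ i - q0 $ j)"
          by (rule LIMSEQ_le_const2[of "\<lambda>n. norm (qpart (Xs n z) $ i - qpart (Xs n z) $ j - cvec (q0 $ i - q0 $ j))"])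
            (use tb in \<open>auto simp: inner_tube_def tube_def intro!: tendsto_intros q\<close>)
        show "norm (vpart (X z) $ i - cvec (v0 $ i)) \<le> 97/1000 * s G m q0 v0 * K G m q0 i"
          by (rule LIMSEQ_le_const2[of "\<lambda>n. norm (vpart (Xs n z) $ i - cvec (v0 $ i))"])
            (use tb in \<open>auto simp: inner_tube_def tube_def intro!: tendsto_intros v\<close>)
      qed
    qed
    moreover have "X (of_real t) p \<in> \<real>" if "\<bar>t\<bar> < \<beta>" for t p
    proof (rule closed_sequentially[OF closed_complex_Reals, of "\<lambda>n. Xs n (of_real t) p"])
      show "Xs n (of_real t) p \<in> \<real>" for n using AX that unfolding A_def by blast
      show "(\<lambda>n. Xs n (of_real t) p) \<longlonglongrightarrow> X (of_real t) p" using that by (intro lim) simp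
    qed
    ultimately show "A X" by (simp add: A_def)
  next
    fix X p assume "A X" and hol: "\<And>p. (\<lambda>z. X z p) holomorphic_on ball 0 \<beta>"
    then show "(\<lambda>z. vfield G m (X z) p) holomorphic_on ball 0 \<beta>"
      by (intro vfield_holomorphic hol tube_slit[OF state_assms, of _ _ v0]) (auto simp: A_def inner_tube_subset)
  qed (use beta_pos L in \<open>auto simp: A_def\<close>)
  show thesis
  proof (rule that[of X])
    show "X 0 = pack (complexify q0) (complexify v0)" using X(2) by (simp add: x0_def)
    show "(qpart (X z), vpart (X z)) \<in> slit_states G m" if "z \<in> ball 0 \<beta>" for z
      using X(1) that by (intro tube_slit[OF state_assms, of _ _ v0]) (auto simp: A_def inner_tube_subset)
    show "X (of_real t) p \<in> \<real>" if "\<bar>t\<bar> < \<beta>" for t p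
      using X(1) that unfolding A_def by blast
  qed (use X(3) in auto)
qed

end

section \<open>Real solutions: uniqueness and continuation by a fixed step\<close>

text \<open>A continuation argument that uses only locality, uniqueness and a step length common to all states.
  From an interval \<open>(-a, a)\<close>, solutions started at \<open>a - d\<close> and \<open>d - a\<close> reach beyond both ends by \<open>d\<close>.\<close>

lemma global_continuation:
  fixes Sol :: "real set \<Rightarrow> (real \<Rightarrow> 'a) \<Rightarrow> bool" and d :: real and c :: 'a
  assumes d: "d > 0"
    and sub: "\<And>J J' x. Sol J x \<Longrightarrow> J' \<subseteq> J \<Longrightarrow> Sol J' x"
    and local: "\<And>J x. (\<And>t. t \<in> J \<Longrightarrow> \<exists>N y. open N \<and> t \<in> N \<and> Sol N y \<and> (\<forall>r\<in>N. x r = y r)) \<Longrightarrow> Sol J x"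
    and uniq: "\<And>a b x y t r. Sol {a<..<b} x \<Longrightarrow> Sol {a<..<b} y \<Longrightarrow> t \<in> {a<..<b} \<Longrightarrow> x t = y t
        \<Longrightarrow> r \<in> {a<..<b} \<Longrightarrow> x r = y r"
    and ext: "\<And>c t. ok c \<Longrightarrow> \<exists>y. y t = c \<and> Sol {t - 2 * d<..<t + 2 * d} y"
    and okS: "\<And>J x t. Sol J x \<Longrightarrow> t \<in> J \<Longrightarrow> ok (x t)"
    and c: "ok c"
  obtains x where "x 0 = c" "Sol UNIV x"
proof -
  have step: "\<exists>x'. x' 0 = c \<and> Sol {-(a + d)<..<a + d} x'"
    if x: "x 0 = c" "Sol {-a<..<a} x" and a: "a \<ge> 2 * d" for a x
  proof -
    define t where "t = a - d"
    have t: "t \<ge> d" "t < a" using a d by (auto simp: t_def)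
    obtain y where y: "y t = x t" "Sol {t - 2 * d<..<t + 2 * d} y"
      using ext[OF okS[OF x(2), of t], of t] t d by auto
    obtain z where z: "z (-t) = x (-t)" "Sol {-t - 2 * d<..<-t + 2 * d} z"
      using ext[OF okS[OF x(2), of "-t"], of "-t"] t d by auto
    have yx: "y r = x r" if "t - 2 * d < r" "r < a" for r
    proof (rule uniq[where a = "t - 2 * d" and b = a and t = t])
      show "Sol {t - 2 * d<..<a} y" by (rule sub[OF y(2)]) (use t_def d in auto)
      show "Sol {t - 2 * d<..<a} x" by (rule sub[OF x(2)]) (use t_def a d in auto)
    qed (use y that t d in auto)
    have zx: "z r = x r" if "-a < r" "r < -t + 2 * d" for r
    proof (rule uniq[where a = "-a" and b = "-t + 2 * d" and t = "-t"])
      show "Sol {-a<..<-t + 2 * d} z" by (rule sub[OF z(2)]) (use t_def d in auto)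
      show "Sol {-a<..<-t + 2 * d} x" by (rule sub[OF x(2)]) (use t_def a d in auto)
    qed (use z that t d in auto)
    define x' where "x' = (\<lambda>r. if r \<le> -t then z r else if r < t then x r else y r)"
    have "Sol {-(a + d)<..<a + d} x'"
    proof (rule local)
      fix r assume r: "r \<in> {-(a + d)<..<a + d}"
      consider "r < -t + d" | "-t < r" "r < t" | "t - d < r" using d by fastforce
      then show "\<exists>N y. open N \<and> r \<in> N \<and> Sol N y \<and> (\<forall>u\<in>N. x' u = y u)"
      proof cases
        case 1
        have "Sol {-(a + d)<..<-t + d} z" by (rule sub[OF z(2)]) (use t_def d in auto)
        moreover have "\<forall>u\<in>{-(a + d)<..<-t + d}. x' u = z u"
          using t d by (auto simp: x'_def zx)
        ultimately show ?thesis using 1 r by (intro exI[of _ "{-(a + d)<..<-t + d}"] exI[of _ z]) auto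
      next
        case 2
        have "Sol {-t<..<t} x" by (rule sub[OF x(2)]) (use t in auto)
        then show ?thesis using 2 by (intro exI[of _ "{-t<..<t}"] exI[of _ x]) (auto simp: x'_def)
      next
        case 3
        have "Sol {t - d<..<a + d} y" by (rule sub[OF y(2)]) (use t_def d in auto)
        moreover have "\<forall>u\<in>{t - d<..<a + d}. x' u = y u"
          using t d yx by (auto simp: x'_def)
        ultimately show ?thesis using 3 r by (intro exI[of _ "{t - d<..<a + d}"] exI[of _ y]) auto
      qed
    qed
    moreover have "x' 0 = c" using t d x by (simp add: x'_def)
    ultimately show ?thesis by blast
  qed
  define h where "h = (\<lambda>n::nat. (real n + 2) * d)"
  have "\<exists>x. x 0 = c \<and> Sol {-h n<..<h n} x" for n
  proof (induction n)
    case 0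
    show ?case using ext[OF c, of 0] by (simp add: h_def)
  next
    case (Suc n)
    then obtain x where "x 0 = c" "Sol {-h n<..<h n} x" by blast
    moreover have "h n \<ge> 2 * d" using d by (simp add: h_def)
    moreover have "h (Suc n) = h n + d" by (simp add: h_def algebra_simps)
    ultimately show ?case using step by metis
  qed
  then obtain X where X: "\<And>n. X n 0 = c" "\<And>n. Sol {-h n<..<h n} (X n)" by metis
  have h0: "h n > 0" for n using d by (simp add: h_def)
  have agree: "X i r = X j r" if "\<bar>r\<bar> < h i" "\<bar>r\<bar> < h j" for i j r
  proof (rule uniq[where a = "- min (h i) (h j)" and b = "min (h i) (h j)" and t = 0])
    show "Sol {- min (h i) (h j)<..<min (h i) (h j)} (X i)" by (rule sub[OF X(2)]) auto
    show "Sol {- min (h i) (h j)<..<min (h i) (h j)} (X j)" by (rule sub[OF X(2)]) auto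
  qed (use X(1) h0 that in auto)
  define n where "n = (\<lambda>r. nat \<lceil>\<bar>r\<bar> / d\<rceil>)"
  have n: "\<bar>r\<bar> < h (n r)" for r
  proof -
    have "\<bar>r\<bar> / d \<le> real (n r)" unfolding n_def by linarith
    then have "\<bar>r\<bar> \<le> real (n r) * d" using d by (simp add: field_simps)
    then show ?thesis using d by (simp add: h_def algebra_simps)
  qed
  define x where "x = (\<lambda>r. X (n r) r)"
  have "Sol UNIV x"
  proof (rule local)
    fix t :: real
    have "\<forall>r\<in>{-h (n t)<..<h (n t)}. x r = X (n t) r"
      unfolding x_def by (intro ballI agree n) auto
    moreover have "t \<in> {-h (n t)<..<h (n t)}" using n[of t] by auto
    ultimately show "\<exists>N y. open N \<and> t \<in> N \<and> Sol N y \<and> (\<forall>r\<in>N. x r = y r)"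
      using X(2) open_greaterThanLessThan by blast
  qed
  then show thesis using that[of x] X(1) by (simp add: x_def)
qed

text \<open>A state and its derivative as families of scalars, so that uniqueness becomes an estimate for finitely
  many real functions.\<close>

definition rpack :: "(real, 'n::finite) config \<times> (real, 'n) config \<Rightarrow> bool \<times> 'n \<times> 3 \<Rightarrow> real" where
  "rpack x = (\<lambda>(b, i, k). if b then snd x $ i $ k else fst x $ i $ k)"

definition rfield :: "real \<Rightarrow> ('n::{finite,linorder} \<Rightarrow> real) \<Rightarrow> (real, 'n) config \<times> (real, 'n) config \<Rightarrow> bool \<times> 'n \<times> 3 \<Rightarrow> real" where
  "rfield G m x = (\<lambda>(b, i, k). s G m (fst x) (snd x) * (if b then accel G m (fst x) i $ k else snd x $ i $ k))"

definition Sol :: "real \<Rightarrow> ('n::{finite,linorder} \<Rightarrow> real) \<Rightarrow> real set \<Rightarrow> (real \<Rightarrow> (real, 'n) config \<times> (real, 'n) config) \<Rightarrow> bool" where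
  "Sol G m J x \<longleftrightarrow> solves G m real_states J (\<lambda>t. fst (x t)) (\<lambda>t. snd (x t))"

definition cpack :: "(real, 'n::finite) config \<times> (real, 'n) config \<Rightarrow> bool \<times> 'n \<times> 3 \<Rightarrow> complex" where
  "cpack x = pack (complexify (fst x)) (complexify (snd x))"

lemma rpack_inj: "rpack x = rpack y \<Longrightarrow> x = y"
proof -
  assume *: "rpack x = rpack y"
  have "fst x $ i $ k = fst y $ i $ k" "snd x $ i $ k = snd y $ i $ k" for i k
    using fun_cong[OF *, of "(False, i, k)"] fun_cong[OF *, of "(True, i, k)"] by (auto simp: rpack_def)
  then show "x = y" by (auto simp: prod_eq_iff vec_eq_iff)
qed

lemma cpack_rpack: "cpack x p = of_real (rpack x p)"
  by (cases p) (auto simp: cpack_def rpack_def pack_def complexify_nth)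

lemma vfield_cpack:
  assumes "G > 0" "\<forall>i. m i > 0"
  shows "vfield G m (cpack x) p = of_real (rfield G m x p)"
proof -
  obtain b i k where "p = (b, i, k)" by (cases p)
  then show ?thesis by (simp only: cpack_def vfield_complexify[OF assms] rfield_def split_conv)
qed

lemma Sol_iff: "Sol G m J x \<longleftrightarrow> (\<forall>t\<in>J. fst (x t) \<notin> collisions \<and>
    (\<forall>p. ((\<lambda>t. rpack (x t) p) has_real_derivative rfield G m (x t) p) (at t)))"
proof -
  have "(\<forall>p. ((\<lambda>t. rpack (x t) p) has_real_derivative rfield G m (x t) p) (at t)) \<longleftrightarrow>
     (\<forall>i k. ((\<lambda>t. fst (x t) $ i $ k) has_field_derivative s G m (fst (x t)) (snd (x t)) * snd (x t) $ i $ k) (at t) \<and>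
       ((\<lambda>t. snd (x t) $ i $ k) has_field_derivative
            s G m (fst (x t)) (snd (x t)) * accel G m (fst (x t)) i $ k) (at t))" for t
    unfolding split_paired_All all_bool_eq rpack_def rfield_def by auto
  then show ?thesis unfolding Sol_def solves_def real_states_def by (auto simp: mem_Times_iff)
qed

lemma Sol_deriv:
  "Sol G m J x \<Longrightarrow> t \<in> J \<Longrightarrow> ((\<lambda>t. rpack (x t) p) has_real_derivative rfield G m (x t) p) (at t)"
  unfolding Sol_iff by blast

lemma Sol_isCont: "Sol G m J x \<Longrightarrow> t \<in> J \<Longrightarrow> isCont (\<lambda>t. rpack (x t) p) t"
  by (rule DERIV_isCont[OF Sol_deriv])

context
  fixes G :: real and m :: "'n::{finite,linorder} \<Rightarrow> real"
  assumes two: "CARD('n) \<ge> 2" and G: "G > 0" and m: "\<forall>i. m i > 0"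
begin

text \<open>The complex tube around the common state also serves real solutions: both stay in it for a short
  time, and there the field is Lipschitz.\<close>

lemma Sol_locally_unique:
  assumes J: "open J" and t0: "t0 \<in> J" and X: "Sol G m J x" and Y: "Sol G m J y" and eq: "x t0 = y t0"
  shows "\<exists>e>0. \<forall>t. \<bar>t - t0\<bar> < e \<longrightarrow> x t = y t"
proof -
  define q0 v0 where "q0 = fst (x t0)" and "v0 = snd (x t0)"
  have ncol: "q0 \<notin> collisions" using X t0 by (simp add: Sol_iff q0_def)
  note state_assms = two G m ncol
  have base: "cpack (x t0) = pack (complexify q0) (complexify v0)" by (simp add: cpack_def q0_def v0_def)
  obtain \<delta> where \<delta>: "\<delta> > 0"
    "\<And>w. (\<And>p. cmod (w p - pack (complexify q0) (complexify v0) p) \<le> \<delta>) \<Longrightarrow> w \<in> inner_tube G m q0 v0"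
    by (rule tube_room[OF state_assms, of v0]) blast
  obtain L where L0: "\<And>w w' p. w \<in> inner_tube G m q0 v0 \<Longrightarrow> w' \<in> inner_tube G m q0 v0 \<Longrightarrow>
      cmod (vfield G m w p - vfield G m w' p) \<le> L * (\<Sum>p\<in>UNIV. cmod (w p - w' p))"
    using vfield_lipschitz[OF state_assms, of v0] by blast
  have L: "cmod (vfield G m w p - vfield G m w' p) \<le> (\<bar>L\<bar> + 1) * (\<Sum>p\<in>UNIV. cmod (w p - w' p))"
    if "w \<in> inner_tube G m q0 v0" "w' \<in> inner_tube G m q0 v0" for w w' p
    by (rule order_trans[OF L0[OF that]]) (auto intro!: mult_right_mono sum_nonneg)
  define N where "N = real CARD(bool \<times> 'n \<times> 3)"
  have N: "N > 0" unfolding N_def by (simp only: of_nat_0_less_iff zero_less_card_finite)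
  have near: "\<exists>e>0. \<forall>t. \<bar>t - t0\<bar> < e \<longrightarrow> cpack (z t) \<in> inner_tube G m q0 v0"
    if Z: "Sol G m J z" and z0: "z t0 = x t0" for z
  proof -
    have "\<forall>\<^sub>F t in at t0. \<forall>p. \<bar>rpack (z t) p - rpack (z t0) p\<bar> < \<delta>"
    proof (rule eventually_all_finite)
      fix p
      have "isCont (\<lambda>t. rpack (z t) p) t0" using Z t0 by (rule Sol_isCont)
      then show "\<forall>\<^sub>F t in at t0. \<bar>rpack (z t) p - rpack (z t0) p\<bar> < \<delta>"
        unfolding isCont_def using \<delta>(1) by (auto dest: tendstoD simp: dist_real_def)
    qed
    then obtain e where e: "e > 0" "\<And>t p. t \<noteq> t0 \<Longrightarrow> \<bar>t - t0\<bar> < e \<Longrightarrow> \<bar>rpack (z t) p - rpack (z t0) p\<bar> < \<delta>"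
      unfolding eventually_at by (auto simp: dist_real_def)
    have "cpack (z t) \<in> inner_tube G m q0 v0" if "\<bar>t - t0\<bar> < e" for t
    proof (rule \<delta>(2))
      fix p
      have "\<bar>rpack (z t) p - rpack (z t0) p\<bar> \<le> \<delta>"
        using e(2)[OF _ that, of p] \<delta>(1) by (cases "t = t0") auto
      then show "cmod (cpack (z t) p - pack (complexify q0) (complexify v0) p) \<le> \<delta>"
        unfolding base[symmetric] cpack_rpack z0 of_real_diff[symmetric] norm_of_real by simp
    qed
    with e(1) show ?thesis by blast
  qed
  obtain e1 where e1: "e1 > 0" "\<And>t. \<bar>t - t0\<bar> < e1 \<Longrightarrow> cpack (x t) \<in> inner_tube G m q0 v0"
    using near[OF X refl] by blast
  obtain e2 where e2: "e2 > 0" "\<And>t. \<bar>t - t0\<bar> < e2 \<Longrightarrow> cpack (y t) \<in> inner_tube G m q0 v0"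
    using near[OF Y eq[symmetric]] by blast
  obtain e3 where e3: "e3 > 0" "ball t0 e3 \<subseteq> J" using J t0 open_contains_ball by blast
  define e where "e = min (min (e1 / 2) (e2 / 2)) (min (e3 / 2) (1 / (2 * N * (\<bar>L\<bar> + 1))))"
  have NL: "2 * N * (\<bar>L\<bar> + 1) > 0" using N by (intro mult_pos_pos) auto
  then have e: "e > 0" using e1 e2 e3 by (simp add: e_def)
  have "e \<le> 1 / (2 * N * (\<bar>L\<bar> + 1))" by (simp add: e_def)
  then have "e * (2 * N * (\<bar>L\<bar> + 1)) \<le> 1" by (simp only: pos_le_divide_eq[OF NL])
  then have small: "N * (\<bar>L\<bar> + 1) * e \<le> 1/2" by (simp add: algebra_simps)
  have inJ: "t \<in> J" if "t \<in> cball t0 e" for t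
    using that e e3 by (intro subsetD[OF e3(2)]) (auto simp: e_def)
  define D where "D = (\<lambda>t. \<Sum>p\<in>UNIV. \<bar>rpack (x t) p - rpack (y t) p\<bar>)"
  have dx: "((\<lambda>t. rpack (x t) p) has_real_derivative rfield G m (x t) p) (at t)"
    and dy: "((\<lambda>t. rpack (y t) p) has_real_derivative rfield G m (y t) p) (at t)" if "t \<in> cball t0 e" for t p
    using Sol_deriv[OF X inJ[OF that]] Sol_deriv[OF Y inJ[OF that]] .
  have "continuous_on (cball t0 e) D"
    unfolding D_def by (intro continuous_on_sum continuous_on_rabs continuous_on_diff
        continuous_at_imp_continuous_on ballI DERIV_isCont[OF dx] DERIV_isCont[OF dy])
  then obtain t1 where t1: "t1 \<in> cball t0 e" "\<And>t. t \<in> cball t0 e \<Longrightarrow> D t \<le> D t1"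
    using continuous_attains_sup[of "cball t0 e" D] e by auto
  have D0: "D t \<ge> 0" for t unfolding D_def by (intro sum_nonneg) auto
  \<comment> \<open>at a maximum of the distance, the mean value theorem bounds the distance by half of itself\<close>
  have "\<bar>rpack (x t1) p - rpack (y t1) p\<bar> \<le> ((\<bar>L\<bar> + 1) * D t1) * e" for p
  proof -
    have "norm ((rpack (x t1) p - rpack (y t1) p) - (rpack (x t0) p - rpack (y t0) p)) \<le> ((\<bar>L\<bar> + 1) * D t1) * norm (t1 - t0)"
    proof (rule field_differentiable_bound[where S = "cball t0 e" and f = "\<lambda>t. rpack (x t) p - rpack (y t) p"
          and f' = "\<lambda>t. rfield G m (x t) p - rfield G m (y t) p"])
      fix t assume t: "t \<in> cball t0 e"
      show "((\<lambda>t. rpack (x t) p - rpack (y t) p) has_real_derivative rfield G m (x t) p - rfield G m (y t) p)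
          (at t within cball t0 e)"
        by (rule has_field_derivative_at_within[OF DERIV_diff[OF dx[OF t] dy[OF t]]])
      have "\<bar>t - t0\<bar> \<le> e" using t by (simp add: dist_real_def abs_minus_commute)
      then have "cpack (x t) \<in> inner_tube G m q0 v0" "cpack (y t) \<in> inner_tube G m q0 v0"
        using e1 e2 e by (auto simp: e_def)
      from L[OF this, of p] have "norm (rfield G m (x t) p - rfield G m (y t) p) \<le> (\<bar>L\<bar> + 1) * D t"
        unfolding vfield_cpack[OF G m] cpack_rpack of_real_diff[symmetric] norm_of_real D_def by simp
      also have "\<dots> \<le> (\<bar>L\<bar> + 1) * D t1" using t1(2)[OF t] by (intro mult_left_mono) auto
      finally show "norm (rfield G m (x t) p - rfield G m (y t) p) \<le> (\<bar>L\<bar> + 1) * D t1" .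
    qed (use t1 e in auto)
    also have "\<dots> \<le> ((\<bar>L\<bar> + 1) * D t1) * e"
      using t1(1) D0[of t1] by (intro mult_left_mono) (auto simp: dist_real_def)
    finally show ?thesis using eq by simp
  qed
  then have "D t1 \<le> N * (((\<bar>L\<bar> + 1) * D t1) * e)"
    unfolding D_def N_def by (intro sum_bounded_above) auto
  also have "\<dots> = N * (\<bar>L\<bar> + 1) * e * D t1" by (simp add: mult_ac)
  also have "\<dots> \<le> 1/2 * D t1" using small D0[of t1] by (rule mult_right_mono)
  finally have "D t1 \<le> 0" by simp
  have "x t = y t" if "\<bar>t - t0\<bar> < e" for t
  proof (rule rpack_inj, rule ext)
    fix p
    have "D t \<le> 0" using t1(2)[of t] that \<open>D t1 \<le> 0\<close> by (simp add: dist_real_def abs_minus_commute)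
    then have "D t = 0" using D0[of t] by simp
    then have "\<forall>p\<in>UNIV. \<bar>rpack (x t) p - rpack (y t) p\<bar> = 0"
      unfolding D_def by (subst (asm) sum_nonneg_eq_0_iff) auto
    then show "rpack (x t) p = rpack (y t) p" by (metis UNIV_I abs_eq_0 eq_iff_diff_eq_0)
  qed
  with e show ?thesis by blast
qed

lemma Sol_unique:
  assumes J: "open J" "connected J" and X: "Sol G m J x" and Y: "Sol G m J y"
    and t0: "t0 \<in> J" "x t0 = y t0" and t: "t \<in> J"
  shows "x t = y t"
proof -
  define D where "D = (\<lambda>t. \<Sum>p\<in>UNIV. \<bar>rpack (x t) p - rpack (y t) p\<bar>)"
  have D0: "D t = 0 \<longleftrightarrow> x t = y t" for t
  proof
    assume "D t = 0"
    then have "\<forall>p\<in>UNIV. \<bar>rpack (x t) p - rpack (y t) p\<bar> = 0"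
      unfolding D_def by (subst (asm) sum_nonneg_eq_0_iff) auto
    then have "rpack (x t) p = rpack (y t) p" for p by (metis UNIV_I abs_eq_0 eq_iff_diff_eq_0)
    then show "x t = y t" by (intro rpack_inj ext)
  qed (simp add: D_def)
  define E where "E = {t\<in>J. D t = 0}"
  have "continuous_on J (\<lambda>t. rpack (x t) p)" "continuous_on J (\<lambda>t. rpack (y t) p)" for p
    using X Y by (auto intro!: continuous_at_imp_continuous_on Sol_isCont)
  then have "continuous_on J D" unfolding D_def by (intro continuous_intros)
  then have cl: "closedin (top_of_set J) E"
    unfolding E_def by (rule continuous_closedin_preimage_constant)
  have "open E"
  proof (rule openI)
    fix u assume u: "u \<in> E"
    then have "u \<in> J" "x u = y u" by (auto simp: E_def D0)
    from Sol_locally_unique[OF J(1) this(1) X Y this(2)]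
    obtain e where e: "e > 0" "\<And>t. \<bar>t - u\<bar> < e \<Longrightarrow> x t = y t" by blast
    obtain e' where e': "e' > 0" "ball u e' \<subseteq> J" using J(1) \<open>u \<in> J\<close> open_contains_ball by blast
    have "ball u (min e e') \<subseteq> E"
      using e e' by (auto simp: E_def D0 dist_real_def abs_minus_commute)
    then show "\<exists>T>0. ball u T \<subseteq> E" using e e' by (intro exI[of _ "min e e'"]) auto
  qed
  then have op: "openin (top_of_set J) E" using J(1) by (auto simp: openin_open_eq E_def)
  have "E \<noteq> {}" using t0 by (auto simp: E_def D0)
  then have "E = J" using J(2) cl op unfolding connected_clopen by blast
  then show ?thesis using t by (auto simp: E_def D0)
qed

end

section \<open>The conformal map from the strip onto the disk\<close>

lemma Cayley_disk:
  assumes "Re w > 0"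
  shows "cmod ((w - 1) / (w + 1)) < 1" "w + 1 \<noteq> 0"
proof -
  show "w + 1 \<noteq> 0" using assms by (auto simp: complex_eq_iff)
  have "(cmod (w - 1))\<^sup>2 < (cmod (w + 1))\<^sup>2"
    unfolding cmod_power2 using assms by (simp add: power2_eq_square algebra_simps)
  then have "cmod (w - 1) < cmod (w + 1)" by (rule power2_less_imp_less) simp
  then show "cmod ((w - 1) / (w + 1)) < 1" using \<open>w + 1 \<noteq> 0\<close> by (simp add: norm_divide)
qed

lemma Cayley_inverse_halfplane:
  assumes "cmod z < 1"
  shows "Re ((1 + z) / (1 - z)) > 0" "1 - z \<noteq> 0"
proof -
  show nz: "1 - z \<noteq> 0" using assms by auto
  have "(1 + z) / (1 - z) = (1 + z) * cnj (1 - z) / of_real ((cmod (1 - z))\<^sup>2)"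
    unfolding complex_norm_square using nz by (simp del: complex_cnj_diff)
  then have "Re ((1 + z) / (1 - z)) = Re ((1 + z) * cnj (1 - z)) / (cmod (1 - z))\<^sup>2"
    by (simp only: Re_divide_of_real)
  also have "Re ((1 + z) * cnj (1 - z)) = 1 - (cmod z)\<^sup>2"
    unfolding cmod_power2 by (simp add: power2_eq_square algebra_simps)
  also have "(1 - (cmod z)\<^sup>2) / (cmod (1 - z))\<^sup>2 > 0"
    using assms nz by (intro divide_pos_pos) (auto simp: abs_square_less_1)
  finally show "Re ((1 + z) / (1 - z)) > 0" .
qed

text \<open>The composition of the inverse Cayley transform, from the disk to the right half plane, with the
  logarithm, from the half plane to the strip.\<close>

definition \<sigma>inv :: "complex \<Rightarrow> complex" where
  "\<sigma>inv z = Ln ((1 + z) / (1 - z)) / of_real (pi / (2 * \<beta>))"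

lemma strip_halfplane:
  assumes "\<tau> \<in> strip"
  shows "\<bar>Im (of_real (pi / (2 * \<beta>)) * \<tau>)\<bar> < pi / 2" "Re (exp (of_real (pi / (2 * \<beta>)) * \<tau>)) > 0"
proof -
  define c where "c = pi / (2 * \<beta>)"
  have c: "c > 0" using beta_pos by (simp add: c_def)
  have "c * \<bar>Im \<tau>\<bar> < c * \<beta>"
    using assms c by (intro mult_strict_left_mono) (auto simp: strip_def)
  also have "\<dots> = pi / 2" using beta_pos by (simp add: c_def)
  finally have *: "\<bar>c * Im \<tau>\<bar> < pi / 2" using c by (simp add: abs_mult)
  then have "cos (c * Im \<tau>) > 0" by (intro cos_gt_zero_pi) linarith+
  with * show "\<bar>Im (of_real (pi / (2 * \<beta>)) * \<tau>)\<bar> < pi / 2"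
    "Re (exp (of_real (pi / (2 * \<beta>)) * \<tau>)) > 0"
    unfolding c_def[symmetric] by (simp_all add: Re_exp)
qed

lemma \<sigma>_ball: "\<tau> \<in> strip \<Longrightarrow> \<sigma> \<tau> \<in> ball 0 1"
  unfolding \<sigma>_def using Cayley_disk(1)[OF strip_halfplane(2)] by simp

lemma \<sigma>inv_\<sigma>:
  assumes "\<tau> \<in> strip"
  shows "\<sigma>inv (\<sigma> \<tau>) = \<tau>"
proof -
  define c where "c = pi / (2 * \<beta>)"
  have c: "c \<noteq> 0" using beta_pos by (simp add: c_def)
  define w where "w = exp (of_real c * \<tau>)"
  have w: "w + 1 \<noteq> 0" using Cayley_disk(2)[OF strip_halfplane(2)[OF assms]] by (simp add: w_def c_def)
  have "(1 + (w - 1) / (w + 1)) / (1 - (w - 1) / (w + 1)) = w"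
    using w by (simp add: divide_simps)
  moreover have "Ln w = of_real c * \<tau>"
    unfolding w_def using strip_halfplane(1)[OF assms, folded c_def] pi_gt_zero
    by (intro Ln_exp) linarith+
  moreover have "\<sigma> \<tau> = (w - 1) / (w + 1)" by (simp only: \<sigma>_def w_def c_def)
  ultimately show ?thesis using c by (simp only: \<sigma>inv_def flip: c_def) simp
qed

lemma \<sigma>inv_strip:
  assumes "z \<in> ball 0 1"
  shows "\<sigma>inv z \<in> strip" "\<sigma> (\<sigma>inv z) = z"
proof -
  define c where "c = pi / (2 * \<beta>)"
  have c: "c > 0" using beta_pos by (simp add: c_def)
  define w where "w = (1 + z) / (1 - z)"
  have w: "Re w > 0" and nz: "1 - z \<noteq> 0" using Cayley_inverse_halfplane[of z] assms by (auto simp: w_def)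
  then have w0: "w \<noteq> 0" by auto
  have g: "\<sigma>inv z = Ln w / of_real c" by (simp add: \<sigma>inv_def w_def c_def)
  have "\<bar>Im (Ln w)\<bar> < pi / 2" using w w0 Re_Ln_pos_lt by blast
  then have "\<bar>Im (Ln w)\<bar> / c < \<beta>" using c beta_pos by (simp add: c_def field_simps)
  then show "\<sigma>inv z \<in> strip" using c by (simp add: strip_def g Im_divide_of_real)
  have "of_real c * \<sigma>inv z = Ln w" using c by (simp add: g)
  then have "\<sigma> (\<sigma>inv z) = (w - 1) / (w + 1)" using w0 by (simp add: \<sigma>_def flip: c_def)
  also have "\<dots> = z" using nz by (simp add: w_def divide_simps)
  finally show "\<sigma> (\<sigma>inv z) = z" .
qed

lemma \<sigma>inv_holomorphic: "\<sigma>inv holomorphic_on ball 0 1"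
proof -
  have "(1 + z) / (1 - z) \<notin> \<real>\<^sub>\<le>\<^sub>0" "1 - z \<noteq> 0" if "z \<in> ball 0 1" for z :: complex
    using Cayley_inverse_halfplane[of z] that by (auto simp: complex_nonpos_Reals_iff)
  moreover have "pi / (2 * \<beta>) \<noteq> 0" using beta_pos by simp
  ultimately show ?thesis unfolding \<sigma>inv_def
    by (intro holomorphic_intros) auto
qed

lemma \<sigma>_conformal: "\<sigma> holomorphic_on strip" "bij_betw \<sigma> strip (ball 0 1)"
proof -
  show "\<sigma> holomorphic_on strip" unfolding \<sigma>_def
    using Cayley_disk(2)[OF strip_halfplane(2)] by (intro holomorphic_intros) auto
  show "bij_betw \<sigma> strip (ball 0 1)"
    by (rule bij_betwI[where g = \<sigma>inv]) (use \<sigma>_ball \<sigma>inv_\<sigma> \<sigma>inv_strip in auto)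
qed

lemma power_series_in_\<sigma>:
  assumes "f holomorphic_on strip"
  obtains a where "\<And>z. cmod z < 1 \<Longrightarrow> summable (\<lambda>n. a n * z ^ n)"
    "\<And>\<tau>. \<tau> \<in> strip \<Longrightarrow> (\<lambda>n. a n * \<sigma> \<tau> ^ n) sums f \<tau>"
proof -
  have "(f \<circ> \<sigma>inv) holomorphic_on ball 0 1"
    using \<sigma>inv_strip(1) by (intro holomorphic_on_compose_gen[OF \<sigma>inv_holomorphic assms]) auto
  then have S: "(\<lambda>n. (deriv ^^ n) (f \<circ> \<sigma>inv) 0 / fact n * z ^ n) sums f (\<sigma>inv z)" if "z \<in> ball 0 1" for z
    using holomorphic_power_series[of "f \<circ> \<sigma>inv" 0 1 z] that by simp
  show thesis
  proof (rule that[of "\<lambda>n. (deriv ^^ n) (f \<circ> \<sigma>inv) 0 / fact n"])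
    show "summable (\<lambda>n. (deriv ^^ n) (f \<circ> \<sigma>inv) 0 / fact n * z ^ n)" if "cmod z < 1" for z
      using S[of z] that by (auto simp: sums_iff)
    show "(\<lambda>n. (deriv ^^ n) (f \<circ> \<sigma>inv) 0 / fact n * \<sigma> \<tau> ^ n) sums f \<tau>" if "\<tau> \<in> strip" for \<tau>
      using S[OF \<sigma>_ball[OF that]] \<sigma>inv_\<sigma>[OF that] by simp
  qed
qed

section \<open>Solutions on the strip\<close>

context
  fixes G :: real and m :: "'n::{finite,linorder} \<Rightarrow> real"
  assumes two: "CARD('n) \<ge> 2" and G: "G > 0" and m: "\<forall>i. m i > 0"
begin

text \<open>The solution \<open>X\<close> on the disk is centred at the origin, the real solution \<open>y\<close> that it extends at
  time \<open>t0\<close>; the system is autonomous.\<close>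

lemma local_disk:
  assumes ncol: "fst c \<notin> collisions"
  obtains X y where "X 0 = cpack c"
    "\<And>z p. z \<in> ball 0 \<beta> \<Longrightarrow> ((\<lambda>z. X z p) has_field_derivative vfield G m (X z) p) (at z)"
    "\<And>z. z \<in> ball 0 \<beta> \<Longrightarrow> (qpart (X z), vpart (X z)) \<in> slit_states G m"
    "y t0 = c" "Sol G m {t0 - \<beta><..<t0 + \<beta>} y"
    "\<And>t. t \<in> {t0 - \<beta><..<t0 + \<beta>} \<Longrightarrow> X (of_real (t - t0)) = cpack (y t)"
proof -
  obtain X where X: "X 0 = pack (complexify (fst c)) (complexify (snd c))"
    "\<And>z p. z \<in> ball 0 \<beta> \<Longrightarrow> ((\<lambda>z. X z p) has_field_derivative vfield G m (X z) p) (at z)"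
    "\<And>z. z \<in> ball 0 \<beta> \<Longrightarrow> (qpart (X z), vpart (X z)) \<in> slit_states G m"
    "\<And>t p. \<bar>t\<bar> < \<beta> \<Longrightarrow> X (of_real t) p \<in> \<real>"
    using local_solution[OF two G m ncol, of "snd c"] by metis
  define y where "y = (\<lambda>t. (real_part (qpart (X (of_real (t - t0)))), real_part (vpart (X (of_real (t - t0))))))"
  have Xy: "X (of_real (t - t0)) = cpack (y t)" if "t \<in> {t0 - \<beta><..<t0 + \<beta>}" for t
    unfolding cpack_def y_def fst_conv snd_conv by (rule real_state, rule X(4)) (use that in auto)
  have "Sol G m {t0 - \<beta><..<t0 + \<beta>} y" unfolding Sol_iff
  proof (intro ballI conjI allI)
    fix t assume t: "t \<in> {t0 - \<beta><..<t0 + \<beta>}"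
    then have tb: "of_real (t - t0) \<in> ball (0::complex) \<beta>"
      unfolding mem_ball_0 norm_of_real by (auto simp: abs_less_iff)
    have slit: "(complexify (fst (y t)), complexify (snd (y t))) \<in> slit_states G m"
      using X(3)[OF tb] unfolding Xy[OF t] by (simp add: cpack_def)
    show "fst (y t) \<notin> collisions"
    proof
      assume "fst (y t) \<in> collisions"
      then obtain i j where "i \<noteq> j" "fst (y t) $ i = fst (y t) $ j" by (auto simp: collisions_def)
      moreover have "usq (complexify (fst (y t)) $ i - complexify (fst (y t)) $ j) \<notin> \<real>\<^sub>\<le>\<^sub>0"
        using slit \<open>i \<noteq> j\<close> unfolding slit_states_def by blast
      ultimately show False by (simp add: usq_complexify usq_real)
    qed
    fix p
    have "((\<lambda>r. X (of_real r) p) has_vector_derivative vfield G m (X (of_real (t - t0))) p) (at (t - t0))"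
      by (rule has_vector_derivative_real_field[OF X(2)[OF tb]])
    then have "((\<lambda>r. Re (X (of_real r) p)) has_real_derivative Re (vfield G m (X (of_real (t - t0))) p)) (at (t - t0))"
      unfolding has_real_derivative_iff_has_vector_derivative
      by (rule bounded_linear.has_vector_derivative[OF bounded_linear_Re])
    then have "((\<lambda>r. Re (X (of_real (r - t0)) p)) has_real_derivative rfield G m (y t) p) (at t)"
      unfolding Xy[OF t] vfield_cpack[OF G m] Re_complex_of_real
      using DERIV_shift[of "\<lambda>r. Re (X (of_real r) p)" _ t "- t0"] by simp
    then show "((\<lambda>t. rpack (y t) p) has_real_derivative rfield G m (y t) p) (at t)"
    proof (rule has_field_derivative_transform_within_open)
      fix r assume "r \<in> {t0 - \<beta><..<t0 + \<beta>}"
      from Xy[OF this] show "Re (X (of_real (r - t0)) p) = rpack (y r) p"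
        by (simp only: cpack_rpack Re_complex_of_real)
    qed (use t in auto)
  qed
  moreover have "y t0 = c" using X(1) by (simp add: y_def)
  ultimately show thesis using that[of X y] X Xy by (simp add: cpack_def)
qed

lemma Sol_global:
  assumes "fst c \<notin> collisions"
  obtains x where "x 0 = c" "Sol G m UNIV x"
proof (rule global_continuation[where Sol = "Sol G m" and d = "\<beta> / 2" and ok = "\<lambda>c. fst c \<notin> collisions" and c = c])
  show "\<beta> / 2 > 0" using beta_pos by simp
next
  fix J J' x assume "Sol G m J x" "J' \<subseteq> J"
  then show "Sol G m J' x" by (auto simp: Sol_iff)
next
  fix J x assume loc: "\<And>t. t \<in> J \<Longrightarrow> \<exists>N y. open N \<and> t \<in> N \<and> Sol G m N y \<and> (\<forall>r\<in>N. x r = y r)"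
  show "Sol G m J x" unfolding Sol_iff
  proof
    fix t assume "t \<in> J"
    then obtain N y where N: "open N" "t \<in> N" "Sol G m N y" "\<forall>r\<in>N. x r = y r" using loc by blast
    then have "fst (y t) \<notin> collisions"
      and d: "\<And>p. ((\<lambda>t. rpack (y t) p) has_real_derivative rfield G m (y t) p) (at t)"
      by (auto simp: Sol_iff)
    moreover have "((\<lambda>t. rpack (x t) p) has_real_derivative rfield G m (y t) p) (at t)" for p
      by (rule has_field_derivative_transform_within_open[OF d N(1,2)]) (simp add: N(4))
    ultimately show "fst (x t) \<notin> collisions \<and> (\<forall>p. ((\<lambda>t. rpack (x t) p) has_real_derivative rfield G m (x t) p) (at t))"
      using N by simp
  qed
next
  fix a b :: real and x y t r
  assume "Sol G m {a<..<b} x" "Sol G m {a<..<b} y" "t \<in> {a<..<b}" "x t = y t" "r \<in> {a<..<b}"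
  then show "x r = y r"
    by (intro Sol_unique[OF two G m open_greaterThanLessThan connected_Ioo, of a b x y t r])
next
  fix c :: "(real, 'n) config \<times> (real, 'n) config" and t assume "fst c \<notin> collisions"
  then obtain y where "y t = c" "Sol G m {t - \<beta><..<t + \<beta>} y"
    by (rule local_disk[where ?t0.0 = t]) blast
  then show "\<exists>y. y t = c \<and> Sol G m {t - 2 * (\<beta> / 2)<..<t + 2 * (\<beta> / 2)} y" by auto
next
  fix J x t assume "Sol G m J x" "t \<in> J"
  then show "fst (x t) \<notin> collisions" by (simp add: Sol_iff)
qed (use assms that in auto)

lemma disk_along_solution:
  assumes x: "Sol G m UNIV x"
  shows "\<exists>X. (\<forall>z\<in>ball 0 \<beta>. (qpart (X z), vpart (X z)) \<in> slit_states G m \<and>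
      (\<forall>p. ((\<lambda>z. X z p) has_field_derivative vfield G m (X z) p) (at z))) \<and>
      (\<forall>r\<in>{t - \<beta><..<t + \<beta>}. X (of_real (r - t)) = cpack (x r))"
proof -
  have nc: "fst (x t) \<notin> collisions" using x by (simp add: Sol_iff)
  obtain X y where "X 0 = cpack (x t)" and X:
    "\<And>z p. z \<in> ball 0 \<beta> \<Longrightarrow> ((\<lambda>z. X z p) has_field_derivative vfield G m (X z) p) (at z)"
    "\<And>z. z \<in> ball 0 \<beta> \<Longrightarrow> (qpart (X z), vpart (X z)) \<in> slit_states G m"
    and y: "y t = x t" "Sol G m {t - \<beta><..<t + \<beta>} y"
    "\<And>r. r \<in> {t - \<beta><..<t + \<beta>} \<Longrightarrow> X (of_real (r - t)) = cpack (y r)"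
    by (rule local_disk[OF nc, where ?t0.0 = t]) (rule that)
  have "Sol G m {t - \<beta><..<t + \<beta>} x" using x by (simp add: Sol_iff)
  then have "y r = x r" if "r \<in> {t - \<beta><..<t + \<beta>}" for r
    using Sol_unique[OF two G m open_greaterThanLessThan connected_Ioo y(2), of x t r] y(1) that beta_pos by simp
  then have "\<forall>r\<in>{t - \<beta><..<t + \<beta>}. X (of_real (r - t)) = cpack (x r)" using y(3) by simp
  then show ?thesis using X by (intro exI[of _ X]) blast
qed

text \<open>The value at \<open>z\<close> is taken from the disk centred at \<open>Re z\<close>. It could be taken from any disk containing
  \<open>z\<close>, and therefore near \<open>z\<close> all values come from one and the same local solution.\<close>

lemma complex_continuation:
  assumes x: "Sol G m UNIV x"
  obtains W where "\<And>t. W (of_real t) = cpack (x t)"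
    "\<And>z. z \<in> strip \<Longrightarrow> (qpart (W z), vpart (W z)) \<in> slit_states G m"
    "\<And>z p. z \<in> strip \<Longrightarrow> ((\<lambda>z. W z p) has_field_derivative vfield G m (W z) p) (at z)"
proof -
  obtain X where slit: "\<And>t z. z \<in> ball 0 \<beta> \<Longrightarrow> (qpart (X t z), vpart (X t z)) \<in> slit_states G m"
    and dX: "\<And>t z p. z \<in> ball 0 \<beta> \<Longrightarrow> ((\<lambda>z. X t z p) has_field_derivative vfield G m (X t z) p) (at z)"
    and Xr: "\<And>t r. r \<in> {t - \<beta><..<t + \<beta>} \<Longrightarrow> X t (of_real (r - t)) = cpack (x r)"
    using disk_along_solution[OF x] by metis
  define Y where "Y = (\<lambda>t z. X t (z - of_real t))"
  have shift: "z - of_real t \<in> ball 0 \<beta> \<longleftrightarrow> z \<in> ball (of_real t) \<beta>" for z :: complex and t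
    by (simp add: dist_norm norm_minus_commute)
  have dY: "((\<lambda>z. Y t z p) has_field_derivative vfield G m (Y t z) p) (at z)" if "z \<in> ball (of_real t) \<beta>" for t z p
    using dX[of "z - of_real t" t p] that DERIV_shift[of "\<lambda>z. X t z p" _ z "- of_real t"]
    unfolding shift Y_def by simp
  have holY: "(\<lambda>z. Y t z p) holomorphic_on ball (of_real t) \<beta>" for t p
    using dY by (intro holomorphic_onI) (meson field_differentiable_at_within field_differentiable_def)
  have Yr: "Y t (of_real r) = cpack (x r)" if "\<bar>r - t\<bar> < \<beta>" for t r
    using Xr[of r t] that by (auto simp: Y_def abs_less_iff)
  \<comment> \<open>two local solutions agree with the real solution on a common real interval, hence on the whole lens\<close>
  have agree: "Y t z = Y t' z" if z: "z \<in> ball (of_real t) \<beta>" "z \<in> ball (of_real t') \<beta>" for t t' z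
  proof
    fix p
    define S where "S = ball (complex_of_real t) \<beta> \<inter> ball (of_real t') \<beta>"
    define U where "U = complex_of_real ` {r. \<bar>r - t\<bar> < \<beta> \<and> \<bar>r - t'\<bar> < \<beta>}"
    define \<xi> where "\<xi> = (t + t') / 2"
    have "dist (complex_of_real t) (of_real t') < 2 * \<beta>"
      using z dist_triangle2[of "complex_of_real t" "of_real t'" z] by (simp add: dist_commute)
    then have tt: "\<bar>t - t'\<bar> < 2 * \<beta>"
      unfolding dist_norm of_real_diff[symmetric] norm_of_real .
    have \<xi>: "\<bar>\<xi> - t\<bar> < \<beta>" "\<bar>\<xi> - t'\<bar> < \<beta>" using tt by (auto simp: \<xi>_def field_simps abs_less_iff)
    have "open {r. \<bar>r - t\<bar> < \<beta> \<and> \<bar>r - t'\<bar> < \<beta>}"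
      by (intro open_Collect_conj open_Collect_less continuous_intros)
    then have "\<xi> islimpt {r. \<bar>r - t\<bar> < \<beta> \<and> \<bar>r - t'\<bar> < \<beta>}"
      using \<xi> by (intro interior_limit_point) (simp add: interior_open)
    then have lim: "of_real \<xi> islimpt U"
      unfolding U_def by (simp add: islimpt_isCont_image eventually_at_filter)
    have US: "U \<subseteq> S"
      by (auto simp: U_def S_def dist_norm abs_minus_commute simp flip: of_real_diff)
    have "Y t z p - Y t' z p = 0"
    proof (rule analytic_continuation[where S = S and U = U and \<xi> = "of_real \<xi>" and f = "\<lambda>z. Y t z p - Y t' z p"])
      show "(\<lambda>z. Y t z p - Y t' z p) holomorphic_on S"
        unfolding S_def by (intro holomorphic_on_diff holomorphic_on_subset[OF holY]) auto
      show "open S" "connected S" unfolding S_def by (auto intro!: convex_connected convex_Int)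
      show "U \<subseteq> S" by (rule US)
      show "of_real \<xi> \<in> S" using US \<xi> by (auto simp: U_def)
      show "Y t w p - Y t' w p = 0" if "w \<in> U" for w using that by (auto simp: U_def Yr)
      show "z \<in> S" using z by (simp add: S_def)
    qed (rule lim)
    then show "Y t z p = Y t' z p" by simp
  qed
  define W where "W = (\<lambda>z. Y (Re z) z)"
  have inball: "z \<in> ball (of_real (Re z)) \<beta>" if "z \<in> strip" for z
  proof -
    have "z - of_real (Re z) = \<i> * of_real (Im z)" by (simp add: complex_eq_iff)
    then have "dist (of_real (Re z)) z = \<bar>Im z\<bar>" by (simp add: dist_norm norm_minus_commute norm_mult)
    then show ?thesis using that by (simp add: strip_def)
  qed
  have sub: "w \<in> strip" if "w \<in> ball (of_real t) \<beta>" for w t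
    using that abs_Im_le_cmod[of "w - of_real t"] by (simp add: strip_def dist_norm norm_minus_commute)
  have WY: "W w = Y t w" if "w \<in> ball (of_real t) \<beta>" for t w
    unfolding W_def by (rule agree[OF inball[OF sub[OF that]] that])
  show thesis
  proof (rule that[of W])
    show "W (of_real t) = cpack (x t)" for t using Yr[of t t] beta_pos by (simp add: W_def)
    fix z assume z: "z \<in> strip"
    note b = inball[OF z]
    show "(qpart (W z), vpart (W z)) \<in> slit_states G m"
      using slit[of "z - of_real (Re z)" "Re z"] b unfolding shift by (simp add: W_def Y_def)
    show "((\<lambda>z. W z p) has_field_derivative vfield G m (W z) p) (at z)" for p
      unfolding WY[OF b]
      by (rule has_field_derivative_transform_within_open[OF dY[OF b] open_ball b]) (simp add: WY)
  qed
qed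

end

theorem mainTheorem3:
  fixes G :: real and m :: "'n::{finite,linorder} \<Rightarrow> real" and q0 v0 :: "(real, 'n) config"
  assumes "CARD('n) \<ge> 2" and "G > 0" and "\<forall>i. m i > 0" and "q0 \<notin> collisions"
  shows
    "\<sigma> holomorphic_on strip \<and> bij_betw \<sigma> strip (ball 0 1) \<and>
     (\<exists>(q :: real \<Rightarrow> (real, 'n) config) (v :: real \<Rightarrow> (real, 'n) config).
        solves G m real_states UNIV q v \<and> q 0 = q0 \<and> v 0 = v0 \<and>
        (\<forall>J q' v'. open J \<and> is_interval J \<and> 0 \<in> J \<and>
            solves G m real_states J q' v' \<and> q' 0 = q0 \<and> v' 0 = v0 \<longrightarrow>
            (\<forall>\<tau>\<in>J. q' \<tau> = q \<tau> \<and> v' \<tau> = v \<tau>)) \<and>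
        (\<exists>(Q :: complex \<Rightarrow> (complex, 'n) config) (V :: complex \<Rightarrow> (complex, 'n) config).
           solves G m (slit_states G m) strip Q V \<and>
           (\<forall>\<tau>. Q (of_real \<tau>) = complexify (q \<tau>) \<and> V (of_real \<tau>) = complexify (v \<tau>)) \<and>
           (\<exists>(a :: nat \<Rightarrow> (complex, 'n) config) (b :: nat \<Rightarrow> (complex, 'n) config).
              (\<forall>z i k. norm z < 1 \<longrightarrow>
                 summable (\<lambda>n. a n $ i $ k * z ^ n) \<and> summable (\<lambda>n. b n $ i $ k * z ^ n)) \<and>
              (\<forall>\<tau>\<in>strip. \<forall>i k.
                 (\<lambda>n. a n $ i $ k * \<sigma> \<tau> ^ n) sums (Q \<tau> $ i $ k) \<and>
                 (\<lambda>n. b n $ i $ k * \<sigma> \<tau> ^ n) sums (V \<tau> $ i $ k)))))"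
proof -
  note state_assms = assms(1-3)
  have "fst (q0, v0) \<notin> collisions" using assms(4) by simp
  then obtain x where x: "x 0 = (q0, v0)" "Sol G m UNIV x" by (rule Sol_global[OF state_assms])
  obtain W where W: "\<And>t. W (of_real t) = cpack (x t)"
    "\<And>z. z \<in> strip \<Longrightarrow> (qpart (W z), vpart (W z)) \<in> slit_states G m"
    "\<And>z p. z \<in> strip \<Longrightarrow> ((\<lambda>z. W z p) has_field_derivative vfield G m (W z) p) (at z)"
    by (rule complex_continuation[OF state_assms x(2)]) blast
  define q v where "q = (\<lambda>t. fst (x t))" and "v = (\<lambda>t. snd (x t))"
  define Q V where "Q = (\<lambda>z. qpart (W z))" and "V = (\<lambda>z. vpart (W z))"
  have 1: "solves G m real_states UNIV q v" "q 0 = q0" "v 0 = v0"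
    using x by (simp_all add: Sol_def q_def v_def)
  have 2: "q' \<tau> = q \<tau> \<and> v' \<tau> = v \<tau>" if J: "open J" "is_interval J" "0 \<in> J"
    and sol: "solves G m real_states J q' v'" "q' 0 = q0" "v' 0 = v0" and \<tau>: "\<tau> \<in> J" for J q' v' \<tau>
  proof -
    have "Sol G m J (\<lambda>t. (q' t, v' t))" using sol(1) by (simp add: Sol_def)
    moreover have "Sol G m J x" using x(2) by (simp add: Sol_iff)
    ultimately have "(q' \<tau>, v' \<tau>) = x \<tau>"
      using Sol_unique[OF state_assms J(1) is_interval_connected[OF J(2)], of "\<lambda>t. (q' t, v' t)" x 0 \<tau>] J(3) sol(2,3) x(1) \<tau>
      by simp
    then show ?thesis by (simp add: q_def v_def flip: prod.inject)
  qed
  have 3: "solves G m (slit_states G m) strip Q V"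
    unfolding solves_def
  proof (intro ballI conjI allI)
    fix z i k assume z: "z \<in> strip"
    show "(Q z, V z) \<in> slit_states G m" using W(2)[OF z] by (simp add: Q_def V_def)
    show "((\<lambda>t. Q t $ i $ k) has_field_derivative s G m (Q z) (V z) * V z $ i $ k) (at z)"
      using W(3)[OF z, of "(False, i, k)"] by (simp add: Q_def V_def vfield_def)
    show "((\<lambda>t. V t $ i $ k) has_field_derivative s G m (Q z) (V z) * accel G m (Q z) i $ k) (at z)"
      using W(3)[OF z, of "(True, i, k)"] by (simp add: Q_def V_def vfield_def)
  qed
  have 4: "Q (of_real \<tau>) = complexify (q \<tau>)" "V (of_real \<tau>) = complexify (v \<tau>)" for \<tau>
    by (simp_all add: Q_def V_def q_def v_def W(1) cpack_def)
  have hol: "(\<lambda>z. W z p) holomorphic_on strip" for p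
    using W(3) by (intro holomorphic_onI) (meson field_differentiable_at_within field_differentiable_def)
  have "\<exists>c. (\<forall>z. cmod z < 1 \<longrightarrow> summable (\<lambda>n. c n * z ^ n)) \<and>
      (\<forall>\<tau>\<in>strip. (\<lambda>n. c n * \<sigma> \<tau> ^ n) sums W \<tau> p)" for p
    by (rule power_series_in_\<sigma>[OF hol[of p]]) blast
  then obtain c where c: "\<And>p z. cmod z < 1 \<Longrightarrow> summable (\<lambda>n. c p n * z ^ n)"
    "\<And>p \<tau>. \<tau> \<in> strip \<Longrightarrow> (\<lambda>n. c p n * \<sigma> \<tau> ^ n) sums W \<tau> p" by metis
  define a where "a = (\<lambda>n. qpart (\<lambda>p. c p n))"
  define b where "b = (\<lambda>n. vpart (\<lambda>p. c p n))"
  have 5: "\<forall>z i k. norm z < 1 \<longrightarrow>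
      summable (\<lambda>n. a n $ i $ k * z ^ n) \<and> summable (\<lambda>n. b n $ i $ k * z ^ n)"
    by (simp add: a_def b_def c(1))
  have 6: "\<forall>\<tau>\<in>strip. \<forall>i k. (\<lambda>n. a n $ i $ k * \<sigma> \<tau> ^ n) sums (Q \<tau> $ i $ k) \<and>
      (\<lambda>n. b n $ i $ k * \<sigma> \<tau> ^ n) sums (V \<tau> $ i $ k)"
    by (simp add: a_def b_def Q_def V_def c(2))
  show ?thesis
    using \<sigma>_conformal 1 2 3 4 5 6 by blast
qed

end
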